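(* There exists a randomized algorithm that, given an instance $\mathcal{I}=((P,\mathbb{R}^d,\d),k,r)$ of Hybrid $k$-Clustering with $P\subset \mathbb{R}^d$ (for any dimension $d$), $\d$ the Euclidean distance, and a parameter $\varepsilon\in(0,1)$, runs in time $2^{O\left(k\log k\cdot \varepsilon^{-5}\log^2(1/\varepsilon)\right)}\cdot n^{O(1)}$, where $n=|P|$, and returns, with high probability, a $(1+\varepsilon,1+\varepsilon)$-bicriteria approximation, i.e., a set $X\subseteq\mathbb{R}^d$ with $|X|\le k$ and $\mathsf{cost}_{(1+\varepsilon)r}(P,X)\le(1+\varepsilon)\,\mathrm{OPT}_r$.
   Context: Hybrid $k$-Clustering: an instance is $((P,\mathbb{F},\d),k,r)$ where $P$ is a finite set of clients, $\mathbb{F}$ a (possibly infinite) set of candidate centers, $\d$ a metric on $P\cup\mathbb{F}$, $k$ a positive integer and $r\ge 0$ a real. For a point $p$ and a set $Q$, $\d(p,Q)=\min_{q\in Q}\d(p,q)$ and, for a real $\alpha$, $\d_\alpha(p,Q)=\max\{\d(p,Q)-\alpha,0\}$. For $X\subseteq\mathbb{F}$, $\mathsf{cost}_\alpha(P,X)=\sum_{p\in P}\d_\alpha(p,X)$. $\mathrm{OPT}_r$ is the minimum of $\mathsf{cost}_r(P,X)$ over $X\subseteq\mathbb{F}$ with $|X|\le k$. In the Euclidean setting here, $\mathbb{F}=\mathbb{R}^d$ (continuous) and $P\subset\mathbb{R}^d$. *)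

theory Defs
  imports "HOL-Probability.Probability"
begin

section \<open>Hybrid k-Clustering\<close>

text \<open>The clients are \<open>P\<close>, the candidate centers \<open>F\<close>, the metric \<open>\<delta>\<close>. The distance to a set
  is a minimum and is only used for finite nonempty sets of centers. In Euclidean space the
  infimum in \<open>OPT\<close> is attained.\<close>

definition dist_set :: "('p \<Rightarrow> 'p \<Rightarrow> real) \<Rightarrow> 'p \<Rightarrow> 'p set \<Rightarrow> real" where
  "dist_set \<delta> p Q = Min (\<delta> p ` Q)"

definition dist_excess :: "('p \<Rightarrow> 'p \<Rightarrow> real) \<Rightarrow> real \<Rightarrow> 'p \<Rightarrow> 'p set \<Rightarrow> real" where
  "dist_excess \<delta> \<alpha> p Q = max (dist_set \<delta> p Q - \<alpha>) 0"

definition cost :: "('p \<Rightarrow> 'p \<Rightarrow> real) \<Rightarrow> real \<Rightarrow> 'p set \<Rightarrow> 'p set \<Rightarrow> real" where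
  "cost \<delta> \<alpha> P X = (\<Sum>p\<in>P. dist_excess \<delta> \<alpha> p X)"

definition solutions :: "'p set \<Rightarrow> nat \<Rightarrow> 'p set set" where
  "solutions F k = {X. X \<subseteq> F \<and> finite X \<and> X \<noteq> {} \<and> card X \<le> k}"

definition OPT :: "('p \<Rightarrow> 'p \<Rightarrow> real) \<Rightarrow> 'p set \<Rightarrow> 'p set \<Rightarrow> nat \<Rightarrow> real \<Rightarrow> real" where
  "OPT \<delta> F P k r = (INF X \<in> solutions F k. cost \<delta> r P X)"

definition bicriteria_approx ::
  "('p \<Rightarrow> 'p \<Rightarrow> real) \<Rightarrow> 'p set \<Rightarrow> 'p set \<Rightarrow> nat \<Rightarrow> real \<Rightarrow> real \<Rightarrow> real \<Rightarrow> 'p set \<Rightarrow> bool" where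
  "bicriteria_approx \<delta> F P k r \<alpha> \<beta> X \<longleftrightarrow>
     X \<in> solutions F k \<and> cost \<delta> (\<beta> * r) P X \<le> \<alpha> * OPT \<delta> F P k r"

section \<open>Euclidean space of varying dimension\<close>

text \<open>One algorithm has to serve all dimensions, so \<open>d\<close> must be a value and not a type. The
  points of the \<open>d\<close>-dimensional space are the sequences that vanish from index \<open>d\<close> on.\<close>

type_synonym point = "nat \<Rightarrow> real"

abbreviation euclid :: "nat \<Rightarrow> point set" where
  "euclid d \<equiv> topspace (Euclidean_space d)"

definition euclid_dist :: "nat \<Rightarrow> point \<Rightarrow> point \<Rightarrow> real" where
  "euclid_dist d p q = L2_set (\<lambda>i. p i - q i) {..<d}"

section \<open>Randomized algorithms: a real RAM with points\<close>

text \<open>The memory consists of three unbounded arrays, holding natural numbers, exact real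
  numbers and points; array cells are addressed by natural numbers.

  As usual for the real RAM, real arithmetic is exact and there is no rounding from reals to
  integers. Natural numbers can only be added and (truncatedly) subtracted: with multiplication
  at unit cost, huge numbers could be used to hide exponential work. The only constants in
  programs are natural numbers, so a program cannot contain infinite advice.

  A point is a single datum: adding, scaling and measuring the distance of points are elementary
  operations whatever the dimension is, and coordinates are not accessible. Each of these
  operations is linear in \<open>d\<close> on a machine working with coordinates.\<close>

datatype nexp =
    NConst nat
  | NCell nexp
  | NAdd nexp nexp
  | NSub nexp nexp

datatype rexp =
    RNat nexp
  | RCell nexp
  | RAdd rexp rexp
  | RSub rexp rexp
  | RMul rexp rexp
  | RDiv rexp rexp
  | RSqrt rexp
  | RDist pexp pexp
and pexp =
    PCell nexp
  | PAdd pexp pexp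
  | PScale rexp pexp

datatype bexp =
    NLess nexp nexp
  | RLess rexp rexp
  | BNot bexp
  | BAnd bexp bexp

text \<open>The first argument of an assignment is the address of the cell that is written.\<close>

datatype com =
    Skip
  | NAssign nexp nexp
  | RAssign nexp rexp
  | PAssign nexp pexp
  | Rand nexp nexp
  | Seq com com
  | Cond bexp com com
  | While bexp com

record state =
  nmem :: "nat \<Rightarrow> nat"
  rmem :: "nat \<Rightarrow> real"
  pmem :: "nat \<Rightarrow> point"

primrec nval :: "nexp \<Rightarrow> state \<Rightarrow> nat" where
  "nval (NConst n) s = n"
| "nval (NCell a) s = nmem s (nval a s)"
| "nval (NAdd a b) s = nval a s + nval b s"
| "nval (NSub a b) s = nval a s - nval b s"

primrec rval :: "nat \<Rightarrow> rexp \<Rightarrow> state \<Rightarrow> real"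
  and pval :: "nat \<Rightarrow> pexp \<Rightarrow> state \<Rightarrow> point" where
  "rval d (RNat a) s = real (nval a s)"
| "rval d (RCell a) s = rmem s (nval a s)"
| "rval d (RAdd x y) s = rval d x s + rval d y s"
| "rval d (RSub x y) s = rval d x s - rval d y s"
| "rval d (RMul x y) s = rval d x s * rval d y s"
| "rval d (RDiv x y) s = rval d x s / rval d y s"
| "rval d (RSqrt x) s = sqrt (rval d x s)"
| "rval d (RDist p q) s = euclid_dist d (pval d p s) (pval d q s)"
| "pval d (PCell a) s = pmem s (nval a s)"
| "pval d (PAdd p q) s = (\<lambda>i. pval d p s i + pval d q s i)"
| "pval d (PScale x p) s = (\<lambda>i. rval d x s * pval d p s i)"

primrec bval :: "nat \<Rightarrow> bexp \<Rightarrow> state \<Rightarrow> bool" where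
  "bval d (NLess a b) s \<longleftrightarrow> nval a s < nval b s"
| "bval d (RLess x y) s \<longleftrightarrow> rval d x s < rval d y s"
| "bval d (BNot b) s \<longleftrightarrow> \<not> bval d b s"
| "bval d (BAnd b c) s \<longleftrightarrow> bval d b s \<and> bval d c s"

text \<open>One step of the machine. Expressions are evaluated within one step; since a program is
  fixed for all inputs, their size is a constant. \<open>Rand a b\<close> draws a uniformly random element
  of \<open>{0..b}\<close>. A program has terminated when it has become \<open>Skip\<close>.\<close>

primrec step :: "nat \<Rightarrow> com \<Rightarrow> state \<Rightarrow> (com \<times> state) pmf" where
  "step d Skip s = return_pmf (Skip, s)"
| "step d (NAssign a b) s = return_pmf (Skip, s\<lparr>nmem := (nmem s)(nval a s := nval b s)\<rparr>)"
| "step d (RAssign a x) s = return_pmf (Skip, s\<lparr>rmem := (rmem s)(nval a s := rval d x s)\<rparr>)"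
| "step d (PAssign a p) s = return_pmf (Skip, s\<lparr>pmem := (pmem s)(nval a s := pval d p s)\<rparr>)"
| "step d (Rand a b) s =
     map_pmf (\<lambda>m. (Skip, s\<lparr>nmem := (nmem s)(nval a s := m)\<rparr>)) (pmf_of_set {0..nval b s})"
| "step d (Seq c1 c2) s =
     (if c1 = Skip then return_pmf (c2, s)
      else map_pmf (\<lambda>(c, t). (Seq c c2, t)) (step d c1 s))"
| "step d (Cond b c1 c2) s = return_pmf (if bval d b s then c1 else c2, s)"
| "step d (While b c) s = return_pmf (if bval d b s then Seq c (While b c) else Skip, s)"

primrec run :: "nat \<Rightarrow> nat \<Rightarrow> com \<times> state \<Rightarrow> (com \<times> state) pmf" where
  "run d 0 cs = return_pmf cs"
| "run d (Suc t) cs = bind_pmf (step d (fst cs) (snd cs)) (run d t)"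

text \<open>Termination within \<open>t\<close> steps whatever the outcomes of the random choices are.\<close>

definition halts_within :: "nat \<Rightarrow> nat \<Rightarrow> com \<times> state \<Rightarrow> bool" where
  "halts_within d t cs \<longleftrightarrow> (\<forall>cs' \<in> set_pmf (run d t cs). fst cs' = Skip)"

definition input_state :: "point list \<Rightarrow> nat \<Rightarrow> real \<Rightarrow> real \<Rightarrow> state" where
  "input_state ps k r \<epsilon> =
     \<lparr>nmem = (\<lambda>_. 0)(0 := length ps, 1 := k),
      rmem = (\<lambda>_. 0)(0 := r, 1 := \<epsilon>),
      pmem = (\<lambda>i. if i < length ps then ps ! i else (\<lambda>_. 0))\<rparr>"

definition output_set :: "state \<Rightarrow> point set" where
  "output_set s = pmem s ` {..<nmem s 0}"

section \<open>The time bound\<close>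

text \<open>Logarithms in the bound are at least 1, as is implicit in the \<open>O\<close>-notation: taken
  literally, \<open>k log k\<close> is 0 for \<open>k = 1\<close>, and \<open>log (1/\<epsilon>)\<close> tends to 0 for \<open>\<epsilon>\<close> tending to 1. For
  \<open>k \<ge> 2\<close> and \<open>\<epsilon> \<le> 1/2\<close> this is the ordinary binary logarithm.\<close>

definition lg :: "real \<Rightarrow> real" where
  "lg x = max 1 (log 2 x)"

definition time_bound :: "real \<Rightarrow> nat \<Rightarrow> nat \<Rightarrow> nat \<Rightarrow> real \<Rightarrow> real" where
  "time_bound C c n k \<epsilon> =
     2 powr (C * (real k * lg (real k) * (1 / \<epsilon>) ^ 5 * (lg (1 / \<epsilon>))\<^sup>2)) * real n ^ c"

end

theory Submission
  imports Defs
begin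

text \<open>
  The current centers \<open>X\<close> are improved by random local moves. A client \<open>p\<close> is drawn with probability
  proportional to its excess distance over \<open>(1 + \<epsilon>) r\<close>, together with a random index \<open>j\<close>, and \<open>X\<^sub>j\<close> either
  jumps to \<open>p\<close> or moves towards \<open>p\<close> by the fraction \<open>\<epsilon> / 4\<close> of the way.

  Fix optimal centers \<open>o\<^sub>j\<close> and give cluster \<open>j\<close> the scale \<open>s\<^sub>j\<close>, which is \<open>r\<close> plus its average optimal cost.
  As long as \<open>X\<close> is too expensive, a constant times \<open>\<epsilon>\<close> of the excess lies on clients for which one of
  the two moves makes progress. If \<open>X\<^sub>j\<close> is within \<open>16 s\<^sub>j / \<epsilon>\<close> of \<open>o\<^sub>j\<close>, a client \<open>p\<close> of cluster \<open>j\<close> that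
  pays more than \<open>1 + \<epsilon> / 2\<close> times its optimal cost is further from \<open>X\<^sub>j\<close> than from \<open>o\<^sub>j\<close> by that
  factor, and moving towards it contracts the squared distance from \<open>X\<^sub>j\<close> to \<open>o\<^sub>j\<close> by \<open>1 - \<epsilon> / 4\<close>. Otherwise either the
  clients that pay too much are themselves within \<open>16 s\<^sub>j / \<epsilon>\<close> of \<open>o\<^sub>j\<close>, or all centers are far from \<open>o\<^sub>j\<close> and then
  the typical clients near \<open>o\<^sub>j\<close> carry a constant fraction of the excess of the cluster; in both cases a
  jump brings \<open>X\<^sub>j\<close> close to \<open>o\<^sub>j\<close>. A cluster is settled once \<open>X\<^sub>j\<close> is within \<open>\<epsilon> s\<^sub>j / 2\<close> of \<open>o\<^sub>j\<close>. So
  \<open>O(k / \<epsilon>\<^sup>2)\<close> consecutive lucky moves, each of probability \<open>\<Omega>(\<epsilon> / k)\<close>, lead from arbitrary centers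
  to good ones. No restarts are needed: the loop runs long enough to contain a lucky block and
  remembers the best centers it has seen.
\<close>

section \<open>A program logic\<close>

lemma run_Skip: "run d t (Skip, s) = return_pmf (Skip, s)"
  by (induction t) (simp_all add: bind_return_pmf)

lemma run_add: "run d (t + u) cs = bind_pmf (run d t cs) (run d u)"
  by (induction t arbitrary: cs)
    (auto simp: bind_return_pmf bind_assoc_pmf intro!: bind_pmf_cong)

text \<open>\<open>Skip\<close> steps to itself, so a run that has surely halted keeps its
  distribution under further steps; time bounds can be padded freely.\<close>

lemma run_halted:
  assumes "halts_within d t cs"
  shows "run d (t + u) cs = run d t cs"
proof -
  have "bind_pmf (run d t cs) (run d u) = bind_pmf (run d t cs) return_pmf"
  proof (intro bind_pmf_cong refl)
    fix cs' assume "cs' \<in> set_pmf (run d t cs)"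
    then have "cs' = (Skip, snd cs')" using assms by (auto simp: halts_within_def prod_eq_iff)
    then show "run d u cs' = return_pmf cs'" using run_Skip by metis
  qed
  then show ?thesis by (simp add: run_add bind_return_pmf')
qed

lemma halts_within_mono:
  assumes "halts_within d t cs" "t \<le> u"
  shows "halts_within d u cs" "run d u cs = run d t cs"
proof -
  obtain w where "u = t + w" using assms(2) le_Suc_ex by blast
  then show "run d u cs = run d t cs" using run_halted[OF assms(1)] by simp
  then show "halts_within d u cs" using assms(1) by (simp add: halts_within_def)
qed

text \<open>Random branches may finish \<open>c1\<close> at different times and then start
  \<open>c2\<close> out of step with each other. They agree again once both budgets have elapsed,
  because a halted run no longer changes. The \<open>Suc\<close> pays for the step that discards the
  finished \<open>Skip\<close>.\<close>

lemma run_Seq: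
  assumes "halts_within d t (c1, s)"
    and "\<And>cs. cs \<in> set_pmf (run d t (c1, s)) \<Longrightarrow> halts_within d u (c2, snd cs)"
  shows "run d (Suc (t + u)) (Seq c1 c2, s)
    = bind_pmf (run d t (c1, s)) (\<lambda>cs. run d u (c2, snd cs))"
  using assms
proof (induction t arbitrary: c1 s)
  case 0
  then have "c1 = Skip" by (simp add: halts_within_def)
  then show ?case by (simp add: bind_return_pmf)
next
  case (Suc t)
  show ?case
  proof (cases "c1 = Skip")
    case True
    \<comment> \<open>Here \<open>c1\<close> has finished early: \<open>c2\<close> has more than
      \<open>u\<close> steps left, and the surplus is padding.\<close>
    have "halts_within d u (c2, s)"
      using Suc.prems(2)[of "(Skip, s)"] True by (simp only: run_Skip) simp
    then have "run d (Suc t + u) (c2, s) = run d u (c2, s)"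
      using halts_within_mono(2)[of d u "(c2,s)" "Suc t + u"] by simp
    then show ?thesis
      using True by (simp only: run_Skip bind_return_pmf run.simps(2) step.simps fst_conv snd_conv
        if_True refl)
  next
    case False
    have *: "run d (Suc (t + u)) (Seq c c2, s')
        = bind_pmf (run d t (c, s')) (\<lambda>cs. run d u (c2, snd cs))"
      if "(c, s') \<in> set_pmf (step d c1 s)" for c s'
    proof (rule Suc.IH)
      show "halts_within d t (c, s')"
        using that Suc.prems(1) by (auto simp: halts_within_def)
      show "halts_within d u (c2, snd cs)" if "cs \<in> set_pmf (run d t (c, s'))" for cs
        using that \<open>(c, s') \<in> _\<close> by (intro Suc.prems(2)) force
    qed
    have "run d (Suc (Suc t + u)) (Seq c1 c2, s)
        = bind_pmf (step d c1 s) (\<lambda>(c, s'). run d (Suc (t + u)) (Seq c c2, s'))"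
      using False
      by (subst run.simps(2)) (simp only: step.simps fst_conv snd_conv if_False bind_map_pmf
        case_prod_unfold add_Suc)
    also have "\<dots> = bind_pmf (step d c1 s)
        (\<lambda>(c, s'). bind_pmf (run d t (c, s')) (\<lambda>cs. run d u (c2, snd cs)))"
      using * by (intro bind_pmf_cong) auto
    finally show ?thesis by (simp add: bind_assoc_pmf case_prod_unfold)
  qed
qed

text \<open>A Hoare triple for total correctness in the worst case over all random choices;
  probabilities are treated separately, on top of it.\<close>

definition valid ::
    "nat \<Rightarrow> (state \<Rightarrow> bool) \<Rightarrow> com \<Rightarrow> nat \<Rightarrow> (state \<Rightarrow> bool) \<Rightarrow> bool" where
  "valid d P c t Q \<longleftrightarrow>
     (\<forall>s. P s \<longrightarrow> (\<forall>cs\<in>set_pmf (run d t (c, s)). fst cs = Skip \<and> Q (snd cs)))"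

lemma validD:
  assumes "valid d P c t Q" "P s"
  shows "halts_within d t (c, s)" "\<And>cs. cs \<in> set_pmf (run d t (c, s)) \<Longrightarrow> Q (snd cs)"
  using assms by (auto simp: valid_def halts_within_def)

lemma validI:
  assumes "\<And>s. P s \<Longrightarrow> halts_within d t (c, s)"
    and "\<And>s cs. P s \<Longrightarrow> cs \<in> set_pmf (run d t (c, s)) \<Longrightarrow> Q (snd cs)"
  shows "valid d P c t Q"
  using assms by (auto simp: valid_def halts_within_def)

lemma valid_conseq:
  assumes "valid d P c t Q" "\<And>s. P' s \<Longrightarrow> P s" "\<And>s. Q s \<Longrightarrow> Q' s" "t \<le> t'"
  shows "valid d P' c t' Q'"
proof (rule validI)
  fix s assume "P' s"
  then have h: "halts_within d t (c, s)" using assms(1,2) validD by blast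
  then show "halts_within d t' (c, s)" using assms(4) halts_within_mono by blast
  show "Q' (snd cs)" if "cs \<in> set_pmf (run d t' (c, s))" for cs
    using that halts_within_mono(2)[OF h assms(4)] validD(2)[OF assms(1)] assms(2,3) \<open>P' s\<close>
    by metis
qed

lemma valid_Skip: "valid d Q Skip 0 Q"
  by (simp add: valid_def)

lemma valid_NAssign: "valid d (\<lambda>s. Q (s\<lparr>nmem := (nmem s)(nval a s := nval b s)\<rparr>)) (NAssign a b) 1 Q"
  by (simp add: valid_def bind_return_pmf)

lemma valid_RAssign: "valid d (\<lambda>s. Q (s\<lparr>rmem := (rmem s)(nval a s := rval d x s)\<rparr>)) (RAssign a x) 1 Q"
  by (simp add: valid_def bind_return_pmf)

lemma valid_PAssign: "valid d (\<lambda>s. Q (s\<lparr>pmem := (pmem s)(nval a s := pval d p s)\<rparr>)) (PAssign a p) 1 Q"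
  by (simp add: valid_def bind_return_pmf)

text \<open>The premises come last command first, so that chaining the rule computes weakest
  preconditions backwards from the postcondition.\<close>

lemma valid_Seq:
  assumes "valid d R c2 u Q" "valid d P c1 t R"
  shows "valid d P (Seq c1 c2) (Suc (t + u)) Q"
proof -
  have "run d (Suc (t + u)) (Seq c1 c2, s)
      = bind_pmf (run d t (c1, s)) (\<lambda>cs. run d u (c2, snd cs))" if "P s" for s
    using that assms by (intro run_Seq) (auto dest: validD)
  then show ?thesis
    using assms unfolding valid_def by (simp del: run.simps) blast
qed

lemma valid_Cond:
  assumes "valid d P1 c1 t1 Q" "valid d P2 c2 t2 Q"
  shows "valid d (\<lambda>s. if bval d b s then P1 s else P2 s) (Cond b c1 c2) (Suc (max t1 t2)) Q"
proof -
  have "valid d P1 c1 (max t1 t2) Q" "valid d P2 c2 (max t1 t2) Q"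
    using assms by (auto elim: valid_conseq)
  then show ?thesis by (simp add: valid_def bind_return_pmf)
qed

text \<open>The invariant is indexed by the round and forces exactly \<open>m\<close> rounds. A
  round costs two extra steps, one for the guard and one for leaving the \<open>Seq\<close>; the
  final \<open>1\<close> is the failing guard.\<close>

lemma valid_While:
  assumes "\<And>i. i < m \<Longrightarrow> valid d (I i) c t (I (Suc i))"
    and "\<And>i s. i < m \<Longrightarrow> I i s \<Longrightarrow> bval d b s"
    and "\<And>s. I m s \<Longrightarrow> \<not> bval d b s"
  shows "valid d (I 0) (While b c) (m * (t + 2) + 1) (I m)"
proof -
  have "valid d (I i) (While b c) ((m - i) * (t + 2) + 1) (I m)" if "i \<le> m" for i
    using that
  proof (induction rule: inc_induct)
    case base
    show ?case using assms(3) by (simp add: valid_def bind_return_pmf)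
  next
    case (step i)
    have "valid d (I i) (Seq c (While b c)) (Suc (t + ((m - Suc i) * (t + 2) + 1))) (I m)"
      using step assms(1) by (intro valid_Seq) auto
    also have "Suc (t + ((m - Suc i) * (t + 2) + 1)) = (m - i) * (t + 2)"
      using step(2) by (simp add: Suc_diff_Suc[symmetric])
    finally show ?case
      using assms(2)[of i] step by (simp add: valid_def bind_return_pmf)
  qed
  from this[of 0] show ?thesis by simp
qed

definition For :: "nat \<Rightarrow> nexp \<Rightarrow> com \<Rightarrow> com" where
  "For v e c = Seq (NAssign (NConst v) (NConst 0))
     (While (NLess (NCell (NConst v)) e)
       (Seq c (NAssign (NConst v) (NAdd (NCell (NConst v)) (NConst 1)))))"

text \<open>The body has to preserve the counter \<open>v\<close>, while \<open>I\<close> has to be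
  insensitive to it. In \<open>t + 4\<close> the increment and its \<open>Seq\<close> are added to
  the overhead of the \<open>While\<close>.\<close>

lemma valid_For:
  assumes body: "\<And>i. i < m \<Longrightarrow> valid d (\<lambda>s. I i s \<and> nmem s v = i) c t (\<lambda>s. I (Suc i) s \<and> nmem s v = i)"
    and upd: "\<And>i s x. I i s \<Longrightarrow> I i (s\<lparr>nmem := (nmem s)(v := x)\<rparr>)"
    and bound: "\<And>i s. i \<le> m \<Longrightarrow> I i s \<Longrightarrow> nmem s v = i \<Longrightarrow> nval e s = m"
  shows "valid d (I 0) (For v e c) (m * (t + 4) + 3) (I m)"
proof -
  let ?J = "\<lambda>i s. I i s \<and> nmem s v = i"
  have "valid d (?J i) (Seq c (NAssign (NConst v) (NAdd (NCell (NConst v)) (NConst 1))))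
      (t + 2) (?J (Suc i))" if "i < m" for i
  proof -
    have "valid d (?J i) c t (\<lambda>s. ?J (Suc i) (s\<lparr>nmem := (nmem s)(v := Suc (nmem s v))\<rparr>))"
      by (rule valid_conseq[OF body[OF that]]) (auto intro: upd)
    then have "valid d (?J i) (Seq c (NAssign (NConst v) (NAdd (NCell (NConst v)) (NConst 1))))
        (Suc (t + 1)) (?J (Suc i))"
      by (intro valid_Seq valid_conseq[OF valid_NAssign]) auto
    then show ?thesis by simp
  qed
  then have "valid d (?J 0) (While (NLess (NCell (NConst v)) e)
      (Seq c (NAssign (NConst v) (NAdd (NCell (NConst v)) (NConst 1))))) (m * ((t + 2) + 2) + 1) (?J m)"
  proof (intro valid_While)
    show "bval d (NLess (NCell (NConst v)) e) s" if "i < m" "?J i s" for i s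
      using that bound[of i s] by simp
    show "\<not> bval d (NLess (NCell (NConst v)) e) s" if "?J m s" for s
      using that bound[of m s] by simp
  qed
  from valid_Seq[OF this valid_NAssign]
  show ?thesis unfolding For_def
    by (rule valid_conseq) (auto intro: upd simp: algebra_simps)
qed

lemma valid_pre:
  assumes "valid d P c t Q" "\<And>s. P' s \<Longrightarrow> P s" "t \<le> t'"
  shows "valid d P' c t' Q"
  using valid_conseq[OF assms(1,2) _ assms(3)] by blast

text \<open>Lets a precondition speak of values fixed by earlier random choices, such as the drawn
  client, and treats each value separately.\<close>

lemma valid_ex:
  assumes "\<And>x. valid d (P x) c t Q"
  shows "valid d (\<lambda>s. \<exists>x. P x s) c t Q"
  using assms by (auto simp: valid_def)

lemma valid_Rand:
  "valid d (\<lambda>s. \<forall>m\<le>nval b s. Q (s\<lparr>nmem := (nmem s)(nval a s := m)\<rparr>)) (Rand a b) 1 Q"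
  by (auto simp: valid_def bind_map_pmf bind_return_pmf set_pmf_of_set)

section \<open>Amplification\<close>

primrec iter_pmf :: "nat \<Rightarrow> ('s \<Rightarrow> 's pmf) \<Rightarrow> 's \<Rightarrow> 's pmf" where
  "iter_pmf 0 K s = return_pmf s"
| "iter_pmf (Suc t) K s = bind_pmf (K s) (iter_pmf t K)"

lemma iter_pmf_add: "iter_pmf (t + u) K s = bind_pmf (iter_pmf t K s) (iter_pmf u K)"
  by (induction t arbitrary: s)
    (auto simp: bind_return_pmf bind_assoc_pmf intro!: bind_pmf_cong)

text \<open>The law of total probability, keeping only the contribution of \<open>A\<close>.\<close>

lemma prob_bind_ge:
  fixes \<mu> :: "'s pmf"
  assumes "\<And>s. s \<in> set_pmf \<mu> \<Longrightarrow> s \<in> A \<Longrightarrow> x \<le> measure_pmf.prob (F s) B" "0 \<le> x"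
  shows "measure_pmf.prob \<mu> A * x \<le> measure_pmf.prob (bind_pmf \<mu> F) B"
proof -
  have i: "integrable (measure_pmf \<mu>) (\<lambda>s. measure_pmf.prob (F s) B)"
    by (rule measure_pmf.integrable_const_bound[where B=1]) auto
  have j: "integrable (measure_pmf \<mu>) (\<lambda>s. indicator A s * x)"
    by (rule measure_pmf.integrable_const_bound[where B="\<bar>x\<bar>"]) (auto simp: indicator_def)
  have "measure_pmf.prob \<mu> A * x = (LINT s|measure_pmf \<mu>. indicator A s * x)" by simp
  also have "\<dots> \<le> (LINT s|measure_pmf \<mu>. measure_pmf.prob (F s) B)"
    using assms by (intro integral_mono_AE i j) (auto simp: AE_measure_pmf_iff indicator_def)
  also have "\<dots> = measure_pmf.prob (bind_pmf \<mu> F) B"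
    unfolding measure_pmf_bind
    by (subst measure_pmf.measure_bind[where N="count_space UNIV"])
      (auto simp: measure_pmf_in_subprob_algebra)
  finally show ?thesis .
qed

context
  fixes K :: "'s \<Rightarrow> 's pmf" and I :: "'s set" and G :: "nat \<Rightarrow> 's set" and \<delta> :: real and N :: nat
  assumes closed: "\<And>s. s \<in> I \<Longrightarrow> set_pmf (K s) \<subseteq> I"
    and start: "I \<subseteq> G 0"
    and advance: "\<And>s m. s \<in> I \<Longrightarrow> s \<in> G m \<Longrightarrow> m < N \<Longrightarrow> \<delta> \<le> measure_pmf.prob (K s) (G (Suc m))"
    and absorb: "\<And>s. s \<in> I \<Longrightarrow> s \<in> G N \<Longrightarrow> set_pmf (K s) \<subseteq> G N"
    and delta: "0 \<le> \<delta>" "\<delta> \<le> 1"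
begin

lemma iter_closed: "s \<in> I \<Longrightarrow> set_pmf (iter_pmf t K s) \<subseteq> I"
  by (induction t arbitrary: s) (use closed in auto)

lemma iter_absorb: "s \<in> I \<Longrightarrow> s \<in> G N \<Longrightarrow> set_pmf (iter_pmf t K s) \<subseteq> G N"
proof (induction t arbitrary: s)
  case (Suc t)
  have "set_pmf (iter_pmf t K s') \<subseteq> G N" if "s' \<in> set_pmf (K s)" for s'
    using that closed[OF Suc.prems(1)] absorb[OF Suc.prems] by (intro Suc.IH) auto
  then show ?case by auto
qed simp

text \<open>Each of the \<open>t\<close> missing levels is gained in the next round with probability
  at least \<open>\<delta>\<close>, whatever happened before.\<close>

lemma iter_advance:
  assumes "s \<in> I" "s \<in> G m" "m + t = N"
  shows "\<delta> ^ t \<le> measure_pmf.prob (iter_pmf t K s) (G N)"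
  using assms
proof (induction t arbitrary: s m)
  case 0
  then show ?case by (simp add: indicator_def)
next
  case (Suc t)
  have "\<delta> ^ Suc t \<le> measure_pmf.prob (K s) (G (Suc m)) * \<delta> ^ t"
    using advance[of s m] Suc.prems delta by (simp add: mult_right_mono)
  also have "\<dots> \<le> measure_pmf.prob (bind_pmf (K s) (iter_pmf t K)) (G N)"
    using closed[OF Suc.prems(1)] Suc.prems(3) delta by (intro prob_bind_ge Suc.IH) auto
  finally show ?case by simp
qed

text \<open>All invariant states have level 0, so after a failed block of \<open>N\<close> rounds
  the argument starts afresh from the state reached, without resetting the process. The failure
  probabilities of the \<open>R\<close> blocks multiply, and success is kept because
  \<open>G N\<close> is absorbing.\<close>

lemma iter_amplify:
  assumes "s \<in> I"
  shows "1 - (1 - \<delta> ^ N) ^ R \<le> measure_pmf.prob (iter_pmf (N * R) K s) (G N)"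
  using assms
proof (induction R arbitrary: s)
  case (Suc R)
  let ?\<mu> = "iter_pmf N K s" and ?x = "(1 - \<delta> ^ N) ^ R"
  have x: "0 \<le> ?x" "?x \<le> 1" using delta by (auto simp: power_le_one)
  define p where "p = measure_pmf.prob ?\<mu> (G N)"
  have p: "\<delta> ^ N \<le> p" "p \<le> 1"
    unfolding p_def using iter_advance[of s 0 N] Suc.prems start by auto
  have i: "integrable (measure_pmf ?\<mu>) (\<lambda>s. measure_pmf.prob (iter_pmf (N * R) K s) (G N))"
    by (rule measure_pmf.integrable_const_bound[where B=1]) auto
  have j: "integrable (measure_pmf ?\<mu>) (\<lambda>s. indicator (G N) s * ?x)"
    by (rule measure_pmf.integrable_const_bound[where B="\<bar>?x\<bar>"]) (auto simp: indicator_def)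
  \<comment> \<open>After a successful first block success is certain, otherwise the induction
    hypothesis gives \<open>1 - ?x\<close>; the expectation of this bound is
    \<open>p + (1 - p) * (1 - ?x)\<close>.\<close>
  have "p * ?x + (1 - ?x) = (LINT s'|measure_pmf ?\<mu>. indicator (G N) s' * ?x + (1 - ?x))"
    unfolding p_def by (subst Bochner_Integration.integral_add[OF j]) auto
  also have "\<dots> \<le> (LINT s'|measure_pmf ?\<mu>. measure_pmf.prob (iter_pmf (N * R) K s') (G N))"
  proof (intro integral_mono_AE i)
    show "AE s' in measure_pmf ?\<mu>. indicator (G N) s' * ?x + (1 - ?x)
        \<le> measure_pmf.prob (iter_pmf (N * R) K s') (G N)"
    proof (clarsimp simp: AE_measure_pmf_iff)
      fix s' assume "s' \<in> set_pmf ?\<mu>"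
      then have s': "s' \<in> I" using iter_closed[OF Suc.prems] by blast
      show "indicator (G N) s' * ?x + (1 - ?x) \<le> measure_pmf.prob (iter_pmf (N * R) K s') (G N)"
      proof (cases "s' \<in> G N")
        case True
        have "measure_pmf.prob (iter_pmf (N * R) K s') (G N) = 1"
          using iter_absorb[OF s' True] by (subst measure_pmf.prob_eq_1) (auto simp: AE_measure_pmf_iff)
        then show ?thesis using True by simp
      qed (use Suc.IH[OF s'] in simp)
    qed
  qed (use j in auto)
  also have "\<dots> = measure_pmf.prob (iter_pmf (N * Suc R) K s) (G N)"
    unfolding mult_Suc_right iter_pmf_add measure_pmf_bind
    by (subst measure_pmf.measure_bind[where N="count_space UNIV"])
      (auto simp: measure_pmf_in_subprob_algebra)
  finally have "p * ?x + (1 - ?x) \<le> measure_pmf.prob (iter_pmf (N * Suc R) K s) (G N)" .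
  moreover have "\<delta> ^ N * ?x \<le> p * ?x" using p x by (intro mult_right_mono)
  ultimately show ?case by (simp add: algebra_simps)
qed simp

end

text \<open>The number of rounds is the same on every random path, so the loop is exactly the
  \<open>m\<close>-fold iterate of its body, viewed as a Markov kernel on states.\<close>

lemma run_While_iter:
  assumes "\<And>i. i < m \<Longrightarrow> valid d (I i) c t (I (Suc i))"
    and "\<And>i s. i < m \<Longrightarrow> I i s \<Longrightarrow> bval d b s"
    and "\<And>s. I m s \<Longrightarrow> \<not> bval d b s"
    and "I 0 s"
  shows "run d (m * (t + 2) + 1) (While b c, s)
    = map_pmf (Pair Skip) (iter_pmf m (\<lambda>s. map_pmf snd (run d t (c, s))) s)"
proof -
  let ?K = "\<lambda>s. map_pmf snd (run d t (c, s))"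
  have "run d ((m - i) * (t + 2) + 1) (While b c, s) = map_pmf (Pair Skip) (iter_pmf (m - i) ?K s)"
    if "i \<le> m" "I i s" for i s
    using that
  proof (induction arbitrary: s rule: inc_induct)
    case base
    then show ?case using assms(3) by (simp add: bind_return_pmf)
  next
    case (step i)
    let ?u = "(m - Suc i) * (t + 2) + 1"
    have I: "I (Suc i) (snd cs)" if "cs \<in> set_pmf (run d t (c, s))" for cs
      using that validD(2)[OF assms(1)] step by blast
    have IH: "run d ?u (While b c, snd cs)
        = map_pmf (Pair Skip) (iter_pmf (m - Suc i) ?K (snd cs))"
      if "cs \<in> set_pmf (run d t (c, s))" for cs
      using step.IH I[OF that] by blast
    have "(m - i) * (t + 2) + 1 = Suc (Suc (t + ?u))"
      using step(2) by (simp add: Suc_diff_Suc[symmetric])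
    then have "run d ((m - i) * (t + 2) + 1) (While b c, s)
        = run d (Suc (t + ?u)) (Seq c (While b c), s)"
      using assms(2)[OF step(2)] step.prems
      by (simp only: run.simps(2) step.simps fst_conv snd_conv bind_return_pmf if_True)
    also have "\<dots> = bind_pmf (run d t (c, s)) (\<lambda>cs. run d ?u (While b c, snd cs))"
      using validD(1)[OF assms(1)] step IH by (intro run_Seq) (auto simp: halts_within_def)
    also have "\<dots> = bind_pmf (run d t (c, s))
        (\<lambda>cs. map_pmf (Pair Skip) (iter_pmf (m - Suc i) ?K (snd cs)))"
      using IH by (intro bind_pmf_cong) auto
    also have "\<dots> = map_pmf (Pair Skip) (iter_pmf (Suc (m - Suc i)) ?K s)"
      by (simp add: map_bind_pmf bind_map_pmf)
    finally show ?case using step(2) by (simp add: Suc_diff_Suc)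
  qed
  from this[of 0] assms(4) show ?thesis by simp
qed

lemma prob_Rand:
  assumes "H \<subseteq> {0..nval b s}" "\<And>m. m \<in> H \<Longrightarrow> Q (s\<lparr>nmem := (nmem s)(nval a s := m)\<rparr>)"
  shows "real (card H) / (real (nval b s) + 1)
    \<le> measure_pmf.prob (run d 1 (Rand a b, s)) {cs. Q (snd cs)}"
proof -
  let ?f = "\<lambda>m. (Skip, s\<lparr>nmem := (nmem s)(nval a s := m)\<rparr>)"
  have "real (card H) / (real (nval b s) + 1) = measure_pmf.prob (pmf_of_set {0..nval b s}) H"
    using assms(1) by (simp add: measure_pmf_of_set Int_absorb1 add.commute)
  also have "\<dots> \<le> measure_pmf.prob (pmf_of_set {0..nval b s}) (?f -` {cs. Q (snd cs)})"
    using assms(2) by (intro measure_pmf.finite_measure_mono) auto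
  also have "\<dots> = measure_pmf.prob (run d 1 (Rand a b, s)) {cs. Q (snd cs)}"
    by (simp add: bind_map_pmf bind_return_pmf' run_Skip[of d 0, simplified] map_pmf_def[symmetric]
        measure_map_pmf[symmetric] bind_return_pmf)
  finally show ?thesis .
qed

text \<open>\<open>R\<close> holds surely and guarantees that \<open>c2\<close> terminates;
  \<open>A\<close> is the favourable event, known only to have probability at least
  \<open>x\<close>.\<close>

lemma prob_Seq:
  assumes "valid d P c1 t R" "valid d R c2 u Q" "P s"
    and "x \<le> measure_pmf.prob (run d t (c1, s)) {cs. A (snd cs)}"
    and "\<And>s'. R s' \<Longrightarrow> A s' \<Longrightarrow> y \<le> measure_pmf.prob (run d u (c2, s')) {cs. B (snd cs)}"
    and "0 \<le> y"
  shows "x * y \<le> measure_pmf.prob (run d (Suc (t + u)) (Seq c1 c2, s)) {cs. B (snd cs)}"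
proof -
  have R: "R (snd cs)" if "cs \<in> set_pmf (run d t (c1, s))" for cs
    using that assms(1,3) validD(2) by blast
  have "run d (Suc (t + u)) (Seq c1 c2, s)
      = bind_pmf (run d t (c1, s)) (\<lambda>cs. run d u (c2, snd cs))"
    using validD(1)[OF assms(1,3)] R validD(1)[OF assms(2)] by (intro run_Seq) auto
  moreover have "x * y \<le> measure_pmf.prob (run d t (c1, s)) {cs. A (snd cs)} * y"
    using assms(4,6) by (rule mult_right_mono)
  moreover have "\<dots> \<le> measure_pmf.prob (bind_pmf (run d t (c1, s)) (\<lambda>cs. run d u (c2, snd cs)))
      {cs. B (snd cs)}"
    using R assms(5,6) by (intro prob_bind_ge) auto
  ultimately show ?thesis by simp
qed

lemma prob_valid:
  assumes "valid d P c t Q" "P s"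
  shows "1 \<le> measure_pmf.prob (run d t (c, s)) {cs. Q (snd cs)}"
proof -
  have "AE cs in measure_pmf (run d t (c, s)). Q (snd cs)"
    using validD(2)[OF assms] by (simp add: AE_measure_pmf_iff)
  then have "measure_pmf.prob (run d t (c, s)) {cs. Q (snd cs)} = 1"
    by (subst measure_pmf.prob_eq_1) auto
  then show ?thesis by simp
qed

section \<open>Distances and optimal centers\<close>

text \<open>Centers form a family indexed below \<open>k\<close>, as in the memory of the program;
  repetitions are harmless because the solution is the image, which has at most \<open>k\<close>
  points.\<close>

definition near :: "nat \<Rightarrow> nat \<Rightarrow> (nat \<Rightarrow> point) \<Rightarrow> point \<Rightarrow> real" where
  "near d k X p = Min ((\<lambda>j. euclid_dist d p (X j)) ` {..<k})"

definition excess :: "nat \<Rightarrow> nat \<Rightarrow> (nat \<Rightarrow> point) \<Rightarrow> real \<Rightarrow> point \<Rightarrow> real" where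
  "excess d k X \<alpha> p = max (near d k X p - \<alpha>) 0"

lemma cost_image: "cost (euclid_dist d) \<alpha> P (X ` {..<k}) = (\<Sum>p\<in>P. excess d k X \<alpha> p)"
  by (simp add: cost_def dist_excess_def dist_set_def excess_def near_def image_image)

lemma near_le: "j < k \<Longrightarrow> near d k X p \<le> euclid_dist d p (X j)"
  by (simp add: near_def)

lemma near_attained:
  assumes "k \<ge> 1"
  obtains j where "j < k" "near d k X p = euclid_dist d p (X j)"
proof -
  have "near d k X p \<in> (\<lambda>j. euclid_dist d p (X j)) ` {..<k}"
    unfolding near_def using assms by (intro Min_in) (auto simp: lessThan_empty_iff)
  then show thesis using that by auto
qed

lemma near_Suc:
  "k \<ge> 1 \<Longrightarrow> near d (Suc k) X p = min (near d k X p) (euclid_dist d p (X k))"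
  unfolding near_def lessThan_Suc by (subst image_insert, subst Min_insert) (auto simp: min.commute lessThan_empty_iff)

lemma near_1: "near d (Suc 0) X p = euclid_dist d p (X 0)"
  by (simp add: near_def lessThan_Suc)

lemma euclid_dist_nonneg: "0 \<le> euclid_dist d p q"
  by (simp add: euclid_dist_def L2_set_nonneg)

lemma euclid_dist_commute: "euclid_dist d p q = euclid_dist d q p"
  by (simp add: euclid_dist_def L2_set_def power2_commute)

lemma euclid_dist_triangle: "euclid_dist d p q \<le> euclid_dist d p m + euclid_dist d m q"
  using L2_set_triangle_ineq[of "\<lambda>i. p i - m i" "\<lambda>i. m i - q i" "{..<d}"]
  by (simp add: euclid_dist_def)

lemma euclid_dist_square: "(euclid_dist d p q)\<^sup>2 = (\<Sum>i<d. (p i - q i)\<^sup>2)"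
  by (simp add: euclid_dist_def L2_set_def sum_nonneg)

lemma euclid_eq: "euclid d = {x. \<forall>i\<ge>d. x i = 0}"
  by (simp add: topspace_Euclidean_space)

section \<open>Existence of optimal centers by compactness\<close>

lemma continuous_euclid_dist: "continuous_on S (\<lambda>X :: nat \<Rightarrow> point. euclid_dist d p (X j))"
proof -
  have "continuous_on S (\<lambda>X :: nat \<Rightarrow> nat \<Rightarrow> real. X j i)" for i
    by (intro continuous_on_product_then_coordinatewise[of _ "\<lambda>X. X j"]
        continuous_on_product_then_coordinatewise[of _ "\<lambda>X. X"] continuous_on_id)
  then show ?thesis
    unfolding euclid_dist_def L2_set_def by (auto intro!: continuous_intros)
qed

lemma continuous_near:
  assumes "k \<ge> 1"
  shows "continuous_on S (\<lambda>X. near d k X p)"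
  using assms
proof (induction k rule: dec_induct)
  case base
  show ?case by (simp add: near_1 continuous_euclid_dist)
next
  case (step k)
  then show ?case by (auto simp: near_Suc intro!: continuous_on_min continuous_euclid_dist)
qed

text \<open>Tychonoff's theorem, applied once to the coordinates of a point and once to the family
  of points.\<close>

lemma compact_box:
  fixes A :: "nat \<Rightarrow> real set"
  assumes "\<And>i. compact (A i)"
  shows "compact {X :: nat \<Rightarrow> nat \<Rightarrow> real. \<forall>j i. X j i \<in> A i}"
proof -
  have "compact (PiE (UNIV :: nat set) A)"
    using assms by (simp flip: compactin_euclidean_iff euclidean_product_topology add: compactin_PiE)
  then have "compact (PiE (UNIV :: nat set) (\<lambda>_. PiE (UNIV :: nat set) A))"
    using compactin_PiE[of "\<lambda>_. euclidean" "UNIV :: nat set" "\<lambda>_. PiE (UNIV :: nat set) A"]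
    by (simp add: compactin_euclidean_iff euclidean_product_topology)
  also have "PiE UNIV (\<lambda>_. PiE UNIV A) = {X. \<forall>j i. X j i \<in> A i}"
    by (auto simp: PiE_def Pi_def)
  finally show ?thesis .
qed

text \<open>Clamping all coordinates of the centers to a box that contains the clients does not
  increase any distance to a client. So it suffices to minimise over a compact set of families,
  where the continuous cost attains its minimum.\<close>

lemma OPT_attained:
  assumes P: "finite P" and k: "k \<ge> 1"
  obtains O' where "\<And>j. O' j \<in> euclid d"
    "cost (euclid_dist d) r P (O' ` {..<k}) \<le> OPT (euclid_dist d) (euclid d) P k r"
proof -
  obtain B where B: "\<And>p i. p \<in> P \<Longrightarrow> i < d \<Longrightarrow> \<bar>p i\<bar> \<le> B" "0 \<le> B"
  proof
    show "\<bar>p i\<bar> \<le> (\<Sum>p\<in>P. \<Sum>i<d. \<bar>p i\<bar>)" if "p \<in> P" "i < d" for p i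
    proof -
      have "\<bar>p i\<bar> \<le> (\<Sum>i<d. \<bar>p i\<bar>)" using that by (intro member_le_sum) auto
      also have "\<dots> \<le> (\<Sum>p\<in>P. \<Sum>i<d. \<bar>p i\<bar>)"
        using that P by (intro member_le_sum[of p P "\<lambda>p. \<Sum>i<d. \<bar>p i\<bar>"]) (auto intro: sum_nonneg)
      finally show ?thesis .
    qed
  qed (auto intro: sum_nonneg)
  define S where "S = {X :: nat \<Rightarrow> nat \<Rightarrow> real. \<forall>j i. X j i \<in> (if i < d then {-B..B} else {0})}"
  define f where "f X = (\<Sum>p\<in>P. excess d k X r p)" for X
  have "compact S" unfolding S_def by (intro compact_box) auto
  moreover have "(\<lambda>j i. 0) \<in> S" using B(2) by (simp add: S_def)
  moreover have "continuous_on S f"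
    unfolding f_def excess_def using k
    by (intro continuous_on_sum continuous_on_max continuous_on_diff continuous_near continuous_on_const)
  ultimately obtain O' where O': "O' \<in> S" "\<And>X. X \<in> S \<Longrightarrow> f O' \<le> f X"
    using continuous_attains_inf[of S f] by blast
  have "f O' \<le> cost (euclid_dist d) r P X" if X: "X \<in> solutions (euclid d) k" for X
  proof -
    have fin: "finite X" "X \<noteq> {}" "card X \<le> k" using X by (auto simp: solutions_def)
    obtain h where h: "bij_betw h {0..<card X} X" using ex_bij_betw_nat_finite fin by blast
    \<comment> \<open>A solution with fewer than \<open>k\<close> centers becomes a family of length
      \<open>k\<close> by repeating its first center.\<close>
    define g where "g j = (if j < card X then h j else h 0)" for j
    have "0 < card X" using fin by (simp add: card_gt_0_iff)
    then have "g ` {..<k} = h ` {0..<card X}"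
      using fin(3) by (force simp: g_def image_iff)
    then have g: "X = g ` {..<k}" using h by (simp add: bij_betw_def)
    define c where "c j i = (if i < d then max (-B) (min B (g j i)) else 0)" for j i
    have "c \<in> S" using B(2) by (auto simp: S_def c_def)
    have "euclid_dist d p (c j) \<le> euclid_dist d p (g j)" if "p \<in> P" for p j
      unfolding euclid_dist_def L2_set_def
    proof (intro real_sqrt_le_mono sum_mono)
      fix i assume "i \<in> {..<d}"
      then have "\<bar>p i - c j i\<bar> \<le> \<bar>p i - g j i\<bar>"
        using B(1)[OF that, of i] B(2) unfolding c_def abs_le_iff min_def max_def
        by (auto simp: abs_if)
      then show "(p i - c j i)\<^sup>2 \<le> (p i - g j i)\<^sup>2" by (simp add: abs_le_square_iff)
    qed
    then have "near d k c p \<le> near d k g p" if "p \<in> P" for p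
      using that near_attained[OF k, of d g p] near_le[of _ k d c p] by (metis order_trans)
    then have "f c \<le> f g"
      unfolding f_def excess_def by (intro sum_mono max.mono diff_right_mono) auto
    then show ?thesis
      using O'(2)[OF \<open>c \<in> S\<close>] by (simp add: g cost_image f_def)
  qed
  moreover have "{\<lambda>_. 0} \<in> solutions (euclid d) k"
    using k by (auto simp: solutions_def euclid_eq)
  ultimately have "f O' \<le> OPT (euclid_dist d) (euclid d) P k r"
    unfolding OPT_def by (intro cINF_greatest) auto
  moreover have "O' j i = 0" if "d \<le> i" for j i
  proof -
    have "O' j i \<in> (if i < d then {-B..B} else {0})" using O'(1) by (simp add: S_def)
    then show ?thesis using that by simp
  qed
  then have "O' j \<in> euclid d" for j by (simp add: euclid_eq)
  ultimately show thesis by (intro that[of O']) (simp_all add: cost_image f_def)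
qed

section \<open>Progress towards an optimal solution\<close>

lemma near_triangle: 
  assumes "k \<ge> 1"
  shows "near d k X p \<le> euclid_dist d p q + near d k X q"
proof -
  obtain j where "j < k" "near d k X q = euclid_dist d q (X j)"
    using near_attained[OF assms] .
  then show ?thesis
    using near_le[of j k d X p] euclid_dist_triangle[of d p "X j" q] by linarith
qed

text \<open>Stewart's theorem; the source of the contraction when a center moves towards a
  client.\<close>

lemma euclid_dist_interpolate:
  "(euclid_dist d (\<lambda>i. (1 - l) * x i + l * p i) q)\<^sup>2 =
     (1 - l) * (euclid_dist d x q)\<^sup>2 + l * (euclid_dist d p q)\<^sup>2
     - l * (1 - l) * (euclid_dist d x p)\<^sup>2"
  unfolding euclid_dist_square sum_distrib_left sum.distrib[symmetric] sum_subtractf[symmetric]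
  by (intro sum.cong) (auto simp: power2_eq_square algebra_simps)

text \<open>Inverse transform sampling on a grid: client \<open>p\<close> owns the rescaled interval
  from \<open>x\<close> to \<open>y\<close> between its prefix sums, and a half-open interval
  contains at least its length minus one integers.\<close>

lemma card_sample:
  fixes f :: "nat \<Rightarrow> real"
  assumes f: "\<And>p. 0 \<le> f p" and p: "p < n" and W: "W = (\<Sum>q<n. f q)" "0 < W"
  shows "real (b + 1) * f p / W - 1 \<le>
    card {u \<in> {0..b}. (\<Sum>q<p. f q) \<le> W * real u / real (b + 1) \<and>
      W * real u / real (b + 1) < (\<Sum>q<Suc p. f q)}"
proof -
  define x where "x = real (b + 1) * (\<Sum>q<p. f q) / W"
  define y where "y = real (b + 1) * (\<Sum>q<Suc p. f q) / W"
  have x0: "0 \<le> x" unfolding x_def using W f by (auto intro!: sum_nonneg divide_nonneg_pos mult_nonneg_nonneg)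
  have "(\<Sum>q<Suc p. f q) \<le> W"
    unfolding W(1) using p f by (intro sum_mono2) auto
  then have "real (b + 1) * (\<Sum>q<Suc p. f q) \<le> real (b + 1) * W" by (rule mult_left_mono) simp
  then have y1: "y \<le> real (b + 1)" unfolding y_def using W(2) by (simp only: pos_divide_le_eq)
  have xy: "y = x + real (b + 1) * f p / W"
    unfolding x_def y_def by (simp add: algebra_simps add_divide_distrib)
  have *: "(\<Sum>q<p. f q) \<le> W * real u / real (b + 1) \<longleftrightarrow> x \<le> real u"
    "W * real u / real (b + 1) < (\<Sum>q<Suc p. f q) \<longleftrightarrow> real u < y" for u
    unfolding x_def y_def using W(2)
    by (auto simp: field_simps)
  have "{u \<in> {0..b}. (\<Sum>q<p. f q) \<le> W * real u / real (b + 1) \<and>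
      W * real u / real (b + 1) < (\<Sum>q<Suc p. f q)} = {nat \<lceil>x\<rceil>..<nat \<lceil>y\<rceil>}"
    unfolding * using x0 y1 by (auto; linarith)
  moreover have "0 \<le> f p" "x \<le> y" using f W xy by auto
  then have "y - x - 1 \<le> real (nat \<lceil>y\<rceil> - nat \<lceil>x\<rceil>)"
    using x0 by linarith
  ultimately show ?thesis using xy by simp
qed

text \<open>Rounding costs at most one grid point per client, so at most \<open>n\<close> in total;
  by the choice of \<open>b\<close> this is no more than half of the share \<open>c\<close>.\<close>

lemma card_sample_set:
  fixes f :: "nat \<Rightarrow> real"
  assumes f: "\<And>p. 0 \<le> f p" and U: "U \<subseteq> {..<n}" and W: "W = (\<Sum>q<n. f q)" "0 < W"
    and c: "c * W \<le> (\<Sum>p\<in>U. f p)" and b: "2 * real n \<le> c * real (b + 1)"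
  shows "c / 2 * real (b + 1) \<le> card {u \<in> {0..b}. \<exists>p\<in>U. (\<Sum>q<p. f q) \<le> W * real u / real (b + 1) \<and>
      W * real u / real (b + 1) < (\<Sum>q<Suc p. f q)}" (is "_ \<le> real (card ?A)")
proof -
  define B where "B p = {u \<in> {0..b}. (\<Sum>q<p. f q) \<le> W * real u / real (b + 1) \<and>
      W * real u / real (b + 1) < (\<Sum>q<Suc p. f q)}" for p
  have fin: "finite U" using U finite_subset by blast
  have mono: "(\<Sum>q<Suc p. f q) \<le> (\<Sum>q<p'. f q)" if "p < p'" for p p'
    using that f by (intro sum_mono2) auto
  have disj: "B p \<inter> B p' = {}" if "p < p'" for p p'
    using mono[OF that] unfolding B_def by force
  then have disj': "B p \<inter> B p' = {}" if "p \<noteq> p'" for p p'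
    using that by (metis Int_commute nat_neq_iff)
  have finB: "finite (B p)" for p by (simp add: B_def)
  have "real n \<ge> real (card U)" using card_mono[OF _ U] by simp
  then have "c / 2 * real (b + 1) \<le> c * real (b + 1) - real (card U)" using b by linarith
  also have "\<dots> \<le> (\<Sum>p\<in>U. f p) / W * real (b + 1) - real (card U)"
    using c W(2) by (intro diff_right_mono mult_right_mono) (auto simp: field_simps)
  also have "\<dots> = (\<Sum>p\<in>U. f p / W * real (b + 1)) - real (card U)"
    by (simp only: sum_divide_distrib sum_distrib_right)
  also have "\<dots> = (\<Sum>p\<in>U. real (b + 1) * f p / W - 1)"
    unfolding sum_subtractf by (simp add: mult.commute)
  also have "\<dots> \<le> (\<Sum>p\<in>U. real (card (B p)))"
    unfolding B_def using U by (intro sum_mono card_sample[OF f _ W]) auto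
  also have "\<dots> = real (card (\<Union>p\<in>U. B p))"
    using fin disj' finB by (subst card_UN_disjoint) auto
  also have "(\<Union>p\<in>U. B p) = ?A" by (auto simp: B_def)
  finally show ?thesis .
qed

section \<open>Clusters of a reference solution and the mass of useful clients\<close>

locale hybrid =
  fixes d n k :: nat and pt :: "nat \<Rightarrow> point" and r e :: real and opt :: "nat \<Rightarrow> point"
  assumes k: "k \<ge> 1" and r: "r \<ge> 0" and e: "0 < e" "e < 1"
begin

abbreviation "\<Delta> \<equiv> euclid_dist d"

text \<open>\<open>opt\<close> is the reference solution, chosen optimal where the locale is
  interpreted. Ties are broken once and for all, so that the sets \<open>cl j\<close> partition the
  clients.\<close>

definition ctr :: "nat \<Rightarrow> nat" where
  "ctr p = (SOME j. j < k \<and> near d k opt (pt p) = \<Delta> (pt p) (opt j))"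

definition v :: "nat \<Rightarrow> real" where "v p = excess d k opt r (pt p)"

definition w :: "(nat \<Rightarrow> point) \<Rightarrow> nat \<Rightarrow> real" where
  "w X p = excess d k X ((1 + e) * r) (pt p)"

definition cl :: "nat \<Rightarrow> nat set" where "cl j = {p. p < n \<and> ctr p = j}"

definition avg :: "nat \<Rightarrow> real" where "avg j = (\<Sum>p\<in>cl j. v p) / real (card (cl j))"

definition scale :: "nat \<Rightarrow> real" where "scale j = r + avg j"

definition settled :: "(nat \<Rightarrow> point) \<Rightarrow> nat \<Rightarrow> bool" where
  "settled X j \<longleftrightarrow> \<Delta> (X j) (opt j) \<le> e / 2 * scale j"

definition close :: "(nat \<Rightarrow> point) \<Rightarrow> nat \<Rightarrow> bool" where
  "close X j \<longleftrightarrow> \<Delta> (X j) (opt j) \<le> 16 / e * scale j"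

definition witness :: "(nat \<Rightarrow> point) \<Rightarrow> nat \<Rightarrow> bool" where
  "witness X p \<longleftrightarrow> (1 + e / 2) * v p < w X p"

text \<open>\<open>close\<close> decides which move is the right one: in a close cluster a step
  towards a witness contracts, in any other cluster a jump onto the client makes the center
  close.\<close>

definition useful :: "(nat \<Rightarrow> point) \<Rightarrow> nat set" where
  "useful X = {p. p < n \<and> \<not> settled X (ctr p) \<and>
     (if close X (ctr p) then witness X p else \<Delta> (pt p) (opt (ctr p)) \<le> 16 / e * scale (ctr p))}"

lemma ctr: "ctr p < k" "near d k opt (pt p) = \<Delta> (pt p) (opt (ctr p))"
proof -
  have "\<exists>j. j < k \<and> near d k opt (pt p) = \<Delta> (pt p) (opt j)"
    using near_attained[OF k] by metis
  from someI_ex[OF this] show "ctr p < k" "near d k opt (pt p) = \<Delta> (pt p) (opt (ctr p))"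
    by (auto simp: ctr_def)
qed

lemma v_ge: "\<Delta> (pt p) (opt (ctr p)) - r \<le> v p" and v_nonneg: "0 \<le> v p"
  by (auto simp: v_def excess_def ctr)

lemma w_nonneg: "0 \<le> w X p" and w_ge: "near d k X (pt p) - (1 + e) * r \<le> w X p"
  by (auto simp: w_def excess_def)

lemma w_leI: "near d k X (pt p) - (1 + e) * r \<le> x \<Longrightarrow> 0 \<le> x \<Longrightarrow> w X p \<le> x"
  by (auto simp: w_def excess_def)

lemma finite_cl: "finite (cl j)" by (simp add: cl_def)

lemma avg_nonneg: "0 \<le> avg j"
  by (auto simp: avg_def intro!: divide_nonneg_nonneg sum_nonneg v_nonneg)

lemma scale_nonneg: "0 \<le> scale j"
  using r avg_nonneg by (simp add: scale_def)

lemma card_avg: "real (card (cl j)) * avg j = (\<Sum>p\<in>cl j. v p)"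
  \<comment> \<open>For an empty cluster \<open>avg j\<close> is 0 by division by zero, in agreement
    with the empty sum.\<close>
  using finite_cl[of j] by (cases "cl j = {}") (auto simp: avg_def)

lemma sum_cl: "(\<Sum>j<k. \<Sum>p\<in>cl j. f p) = (\<Sum>p<n. (f p :: real))"
  using sum.group[of "{..<n}" "{..<k}" ctr f] ctr(1) by (simp add: cl_def lessThan_def image_subset_iff)

text \<open>The distance of a client to its reference center is at most \<open>v p + r\<close>, and
  \<open>(1 + e / 2) * r\<close> is covered by the enlarged radius \<open>(1 + e) * r\<close>; so
  the factor between the excesses passes on to the distances.\<close>

lemma witness_far:
  assumes "witness X p"
  shows "(1 + e / 2) * \<Delta> (pt p) (opt (ctr p)) < near d k X (pt p)"
proof -
  have "0 \<le> (1 + e / 2) * v p" using e v_nonneg by simp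
  then have "w X p = near d k X (pt p) - (1 + e) * r"
    using assms unfolding witness_def w_def excess_def by linarith
  then have "(1 + e / 2) * v p + (1 + e) * r < near d k X (pt p)"
    using assms by (simp add: witness_def)
  moreover have "(1 + e / 2) * (\<Delta> (pt p) (opt (ctr p)) - r) \<le> (1 + e / 2) * v p"
    using e v_ge by (intro mult_left_mono) auto
  moreover have "0 \<le> e * r" using e r by simp
  ultimately show ?thesis by (simp add: algebra_simps)
qed

text \<open>Of the displacement \<open>e / 2 * (r + avg j)\<close>, the part in \<open>r\<close> is
  absorbed by the enlarged radius, and the part in \<open>avg j\<close> sums over the cluster to
  \<open>e / 2\<close> times its reference cost.\<close>

lemma settled_mass:
  assumes "settled X j" "j < k"
  shows "(\<Sum>p\<in>cl j. w X p) \<le> (1 + e / 2) * (\<Sum>p\<in>cl j. v p)"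
proof -
  have "w X p \<le> v p + e / 2 * avg j" if "p \<in> cl j" for p
  proof (rule w_leI)
    have j: "ctr p = j" using that by (simp add: cl_def)
    have "near d k X (pt p) \<le> \<Delta> (pt p) (opt j) + \<Delta> (opt j) (X j)"
      using near_le[OF assms(2), of d X "pt p"] euclid_dist_triangle[of d "pt p" "X j" "opt j"] by linarith
    also have "\<dots> \<le> v p + r + e / 2 * (r + avg j)"
      using v_ge[of p] assms(1) unfolding j settled_def scale_def euclid_dist_commute[of d "X j"] by linarith
    finally have "near d k X (pt p) \<le> v p + r + e / 2 * r + e / 2 * avg j" by (simp add: algebra_simps)
    moreover have "0 \<le> e / 2 * r" using e r by simp
    ultimately show "near d k X (pt p) - (1 + e) * r \<le> v p + e / 2 * avg j"
      by (simp add: algebra_simps)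
  qed (use v_nonneg avg_nonneg e in simp)
  then have "(\<Sum>p\<in>cl j. w X p) \<le> (\<Sum>p\<in>cl j. v p + e / 2 * avg j)" by (intro sum_mono)
  also have "\<dots> = (\<Sum>p\<in>cl j. v p) + e / 2 * (real (card (cl j)) * avg j)"
    by (simp add: sum.distrib)
  finally show ?thesis unfolding card_avg by (simp add: algebra_simps)
qed

text \<open>Markov's inequality for twice the average; it says nothing when the average is 0, but
  then all excesses vanish.\<close>

lemma card_typical: "real (card (cl j)) \<le> 2 * real (card {q \<in> cl j. v q \<le> 2 * avg j})"
proof (cases "avg j = 0")
  case True
  then have "\<forall>q\<in>cl j. v q = 0"
    using card_avg[of j] sum_nonneg_eq_0_iff[OF finite_cl] v_nonneg by auto
  then have "{q \<in> cl j. v q \<le> 2 * avg j} = cl j" using True by auto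
  then show ?thesis by simp
next
  case False
  then have pos: "0 < avg j" using avg_nonneg[of j] by simp
  let ?T = "{q \<in> cl j. v q \<le> 2 * avg j}"
  have "real (card (cl j - ?T)) * (2 * avg j) = (\<Sum>q\<in>cl j - ?T. 2 * avg j)" by simp
  also have "\<dots> \<le> (\<Sum>q\<in>cl j - ?T. v q)" by (intro sum_mono) auto
  also have "\<dots> \<le> (\<Sum>q\<in>cl j. v q)" using finite_cl v_nonneg by (intro sum_mono2) auto
  also have "\<dots> = real (card (cl j)) * avg j" by (simp add: card_avg)
  finally have "2 * real (card (cl j - ?T)) \<le> real (card (cl j))" using pos by simp
  moreover have "card (cl j - ?T) + card ?T = card (cl j)"
    using finite_cl[of j] card_mono[of "cl j" ?T] by (subst card_Diff_subset) auto
  ultimately show ?thesis by linarith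
qed

text \<open>A far client can be a witness only if every center is far from \<open>opt j\<close>:
  with \<open>x\<close> its distance to \<open>opt j\<close>, comparing
  \<open>(1 + e / 2) * x\<close> with \<open>x + y\<close> gives \<open>8 * scale j < y\<close>.
  Then a client pays at most \<open>y + v q\<close>, on average at most \<open>9 / 8 * y\<close>,
  and a typical one at least \<open>5 / 8 * y\<close>. Half of the cluster is typical, and
  \<open>2 * 9 / 8 \<le> 4 * 5 / 8\<close>.\<close>

lemma far_mass:
  assumes p: "p \<in> cl j" "witness X p" "16 / e * scale j < \<Delta> (pt p) (opt j)"
  shows "(\<Sum>q\<in>cl j. w X q) \<le> 4 * (\<Sum>q\<in>{q \<in> cl j. v q \<le> 2 * avg j}. w X q)"
proof -
  let ?T = "{q \<in> cl j. v q \<le> 2 * avg j}"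
  define y where "y = near d k X (opt j)"
  have j: "ctr p = j" using p by (simp add: cl_def)
  have "(1 + e / 2) * \<Delta> (pt p) (opt j) < \<Delta> (pt p) (opt j) + y"
    using witness_far[OF p(2)] near_triangle[OF k, of d X "pt p" "opt j"] by (simp add: j y_def)
  moreover have "e / 2 * (16 / e * scale j) < e / 2 * \<Delta> (pt p) (opt j)"
    using p(3) e by (intro mult_strict_left_mono) auto
  ultimately have y: "8 * scale j < y" using e by (simp add: algebra_simps)
  have y0: "0 \<le> y" using y scale_nonneg[of j] by linarith
  have up: "w X q \<le> y + v q" if "q \<in> cl j" for q
  proof (rule w_leI)
    have "near d k X (pt q) \<le> \<Delta> (pt q) (opt j) + y"
      unfolding y_def by (rule near_triangle[OF k])
    moreover have "\<Delta> (pt q) (opt j) - r \<le> v q" using v_ge[of q] that by (simp add: cl_def)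
    moreover have "0 \<le> e * r" using e r by simp
    ultimately show "near d k X (pt q) - (1 + e) * r \<le> y + v q" by (simp add: algebra_simps)
  qed (use y0 v_nonneg in simp)
  have low: "5 / 8 * y \<le> w X q" if "q \<in> ?T" for q
  proof -
    have "y \<le> \<Delta> (pt q) (opt j) + near d k X (pt q)"
      using near_triangle[OF k, of d X "opt j" "pt q"] by (simp add: y_def euclid_dist_commute)
    moreover have "\<Delta> (pt q) (opt j) - r \<le> 2 * avg j"
      using v_ge[of q] that by (simp add: cl_def)
    moreover have "e * r \<le> r" using e r by (simp add: mult_left_le_one_le)
    moreover have "near d k X (pt q) - r - e * r \<le> w X q"
      using w_ge[of X q] by (simp add: algebra_simps)
    ultimately have "y \<le> 2 * avg j + 3 * r + w X q" by linarith
    moreover have "3 * r + 3 * avg j \<le> 3 / 8 * y" using y by (simp add: scale_def)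
    ultimately show ?thesis using avg_nonneg[of j] by linarith
  qed
  have "(\<Sum>q\<in>cl j. w X q) \<le> (\<Sum>q\<in>cl j. y + v q)" using up by (intro sum_mono)
  also have "\<dots> = real (card (cl j)) * (y + avg j)"
    by (simp add: sum.distrib card_avg[symmetric] algebra_simps)
  also have "\<dots> \<le> real (card (cl j)) * (9 / 8 * y)"
    using y r by (intro mult_left_mono) (auto simp: scale_def)
  also have "\<dots> \<le> (2 * real (card ?T)) * (9 / 8 * y)"
    using card_typical y0 by (intro mult_right_mono) auto
  also have "\<dots> \<le> 4 * (real (card ?T) * (5 / 8 * y))"
    using y0 by (simp add: algebra_simps)
  also have "real (card ?T) * (5 / 8 * y) = (\<Sum>q\<in>?T. 5 / 8 * y)" by simp
  also have "\<dots> \<le> (\<Sum>q\<in>?T. w X q)" using low by (intro sum_mono)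
  finally show ?thesis by simp
qed

text \<open>A client that is no witness is paid for by its reference cost. In an unsettled cluster a
  witness is useful unless it is far away and the center is not close, and there the typical clients
  take over.\<close>

lemma cluster_mass:
  assumes "j < k"
  shows "(\<Sum>p\<in>cl j. w X p) \<le> 4 * (\<Sum>p\<in>cl j \<inter> useful X. w X p) + (1 + e / 2) * (\<Sum>p\<in>cl j. v p)"
proof -
  have nonneg: "0 \<le> (1 + e / 2) * (\<Sum>p\<in>cl j. v p)" "0 \<le> (\<Sum>p\<in>cl j \<inter> useful X. w X p)"
    using e v_nonneg w_nonneg by (auto intro!: mult_nonneg_nonneg sum_nonneg)
  consider (settled) "settled X j"
    | (near) "\<not> settled X j" "\<And>p. p \<in> cl j \<Longrightarrow> witness X p \<Longrightarrow> p \<in> useful X"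
    | (far) p where "\<not> settled X j" "p \<in> cl j" "witness X p" "p \<notin> useful X" by blast
  then show ?thesis
  proof cases
    case settled
    then show ?thesis using settled_mass[OF settled assms] nonneg by linarith
  next
    case near
    have "(\<Sum>p\<in>cl j. w X p) \<le> (\<Sum>p\<in>cl j. (if p \<in> useful X then w X p else 0) + (1 + e / 2) * v p)"
    proof (intro sum_mono)
      fix p assume "p \<in> cl j"
      then show "w X p \<le> (if p \<in> useful X then w X p else 0) + (1 + e / 2) * v p"
        using near(2)[of p] mult_nonneg_nonneg[OF _ v_nonneg[of p], of "1 + e / 2"] e
        by (cases "p \<in> useful X") (auto simp: witness_def not_less[symmetric])
    qed
    also have "\<dots> = (\<Sum>p\<in>cl j \<inter> useful X. w X p) + (1 + e / 2) * (\<Sum>p\<in>cl j. v p)"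
      by (simp add: sum.distrib sum_distrib_left sum.inter_restrict[OF finite_cl])
    finally show ?thesis using nonneg by linarith
  next
    case far
    have j: "ctr p = j" "p < n" using far(2) by (auto simp: cl_def)
    have nc: "\<not> close X j" and pfar: "16 / e * scale j < \<Delta> (pt p) (opt j)"
      using far j by (auto simp: useful_def split: if_splits)
    \<comment> \<open>A typical client lies within \<open>2 * scale j\<close> of
      \<open>opt j\<close>, which is well inside the radius for a jump.\<close>
    have "{q \<in> cl j. v q \<le> 2 * avg j} \<subseteq> cl j \<inter> useful X"
    proof safe
      fix q assume q: "q \<in> cl j" "v q \<le> 2 * avg j"
      have "\<Delta> (pt q) (opt j) - r \<le> v q" using v_ge[of q] q by (simp add: cl_def)
      then have "\<Delta> (pt q) (opt j) \<le> 2 * scale j"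
        using q r by (simp add: scale_def)
      also have "\<dots> \<le> 16 / e * scale j"
        using e scale_nonneg by (intro mult_right_mono) (auto simp: field_simps)
      finally show "q \<in> useful X" using q nc far(1) by (simp add: useful_def cl_def)
    qed
    then have "(\<Sum>q\<in>{q \<in> cl j. v q \<le> 2 * avg j}. w X q) \<le> (\<Sum>q\<in>cl j \<inter> useful X. w X q)"
      using finite_cl w_nonneg by (intro sum_mono2) auto
    then show ?thesis using far_mass[OF far(2,3) pfar] nonneg by linarith
  qed
qed

text \<open>Summing over the clusters leaves \<open>W \<le> 4 * u + (1 + e / 2) * V\<close>. Since
  \<open>(1 + e) * V < W\<close> and \<open>1 + e / 2 \<le> (1 - e / 4) * (1 + e)\<close>, at least
  \<open>e / 4 * W\<close> remains for \<open>4 * u\<close>.\<close>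

lemma useful_mass:
  assumes "(1 + e) * (\<Sum>p<n. v p) < (\<Sum>p<n. w X p)"
  shows "e / 16 * (\<Sum>p<n. w X p) \<le> (\<Sum>p\<in>useful X. w X p)"
proof -
  define W where "W = (\<Sum>p<n. w X p)"
  define V where "V = (\<Sum>p<n. v p)"
  define u where "u = (\<Sum>p\<in>useful X. w X p)"
  have "(\<Sum>j<k. \<Sum>p\<in>cl j \<inter> useful X. w X p)
      = (\<Sum>j<k. \<Sum>p\<in>cl j. if p \<in> useful X then w X p else 0)"
    by (intro sum.cong refl sum.inter_restrict finite_cl)
  also have "\<dots> = (\<Sum>p<n. if p \<in> useful X then w X p else 0)" by (rule sum_cl)
  also have "\<dots> = u"
    unfolding u_def by (subst sum.inter_restrict[symmetric]) (auto simp: useful_def intro!: sum.cong)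
  finally have u: "(\<Sum>j<k. \<Sum>p\<in>cl j \<inter> useful X. w X p) = u" .
  have "W = (\<Sum>j<k. \<Sum>p\<in>cl j. w X p)" by (simp add: W_def sum_cl)
  also have "\<dots> \<le> (\<Sum>j<k. 4 * (\<Sum>p\<in>cl j \<inter> useful X. w X p) + (1 + e / 2) * (\<Sum>p\<in>cl j. v p))"
    by (intro sum_mono cluster_mass) auto
  also have "\<dots> = 4 * u + (1 + e / 2) * V"
    by (simp add: sum.distrib sum_distrib_left[symmetric] u V_def sum_cl)
  finally have 1: "W \<le> 4 * u + (1 + e / 2) * V" .
  have V: "0 \<le> V" unfolding V_def by (intro sum_nonneg v_nonneg)
  have WV: "(1 + e) * V < W" using assms by (simp add: W_def V_def)
  have "(1 + e / 2) * V \<le> (1 - e / 4) * ((1 + e) * V)"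
  proof -
    have "e * e \<le> e" using e by simp
    then have "1 + e / 2 \<le> (1 - e / 4) * (1 + e)" by (simp add: field_simps)
    then have "(1 + e / 2) * V \<le> ((1 - e / 4) * (1 + e)) * V" using V by (rule mult_right_mono)
    then show ?thesis by (simp add: mult.assoc)
  qed
  also have "\<dots> \<le> (1 - e / 4) * W" using WV e by (intro mult_left_mono) auto
  finally show ?thesis using 1 unfolding W_def[symmetric] u_def[symmetric] by (simp add: algebra_simps)
qed

text \<open>\<open>c j\<close> counts the useful moves made for cluster \<open>j\<close>: the first one brings the center within
  \<open>16 s\<^sub>j / \<epsilon>\<close>, each further one contracts. With \<open>M + 1\<close> moves the cluster is settled.\<close>

definition pot :: "nat \<Rightarrow> (nat \<Rightarrow> point) \<Rightarrow> nat \<Rightarrow> bool" where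
  "pot M X m \<longleftrightarrow> (\<exists>c :: nat \<Rightarrow> nat. (\<Sum>j<k. c j) = m \<and> (\<forall>j<k. c j \<le> M + 1 \<and>
     (0 < c j \<longrightarrow> (\<Delta> (X j) (opt j))\<^sup>2 \<le> (1 - e / 4) ^ (c j - 1) * (16 / e * scale j)\<^sup>2)))"

text \<open>A single random number below \<open>2 * k\<close> encodes both the index of the center
  and the kind of move.\<close>

definition improve :: "(nat \<Rightarrow> point) \<Rightarrow> point \<Rightarrow> nat \<Rightarrow> nat \<Rightarrow> point" where
  "improve X p u = (if u < k then X(u := (\<lambda>i. (1 - e / 4) * X u i + e / 4 * p i)) else X(u - k := p))"

section \<open>Progress measured by the potential\<close>

lemma pot_0: "pot M X 0"
  by (auto simp: pot_def intro!: exI[of _ "\<lambda>_. 0"])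

lemma all_settled_mass:
  assumes "\<And>j. j < k \<Longrightarrow> settled X j"
  shows "(\<Sum>p<n. w X p) \<le> (1 + e) * (\<Sum>p<n. v p)"
proof -
  have "(\<Sum>p<n. w X p) = (\<Sum>j<k. \<Sum>p\<in>cl j. w X p)" by (simp add: sum_cl)
  also have "\<dots> \<le> (\<Sum>j<k. (1 + e / 2) * (\<Sum>p\<in>cl j. v p))"
    using assms by (intro sum_mono settled_mass) auto
  also have "\<dots> = (1 + e / 2) * (\<Sum>p<n. v p)" by (simp add: sum_distrib_left[symmetric] sum_cl)
  also have "\<dots> \<le> (1 + e) * (\<Sum>p<n. v p)"
    using e by (intro mult_right_mono sum_nonneg v_nonneg) auto
  finally show ?thesis .
qed

lemma settledI:
  assumes M: "(1 - e / 4) ^ M * (16 / e)\<^sup>2 \<le> (e / 2)\<^sup>2"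
    and "(\<Delta> (X j) (opt j))\<^sup>2 \<le> (1 - e / 4) ^ M * (16 / e * scale j)\<^sup>2"
  shows "settled X j"
proof -
  have "(\<Delta> (X j) (opt j))\<^sup>2 \<le> ((1 - e / 4) ^ M * (16 / e)\<^sup>2) * (scale j)\<^sup>2"
    using assms(2) by (simp only: power_mult_distrib mult.assoc)
  also have "\<dots> \<le> (e / 2)\<^sup>2 * (scale j)\<^sup>2" using M by (intro mult_right_mono) auto
  also have "\<dots> = (e / 2 * scale j)\<^sup>2" by (simp only: power_mult_distrib)
  finally show ?thesis
    unfolding settled_def
    by (rule power2_le_imp_le) (use e scale_nonneg[of j] in \<open>simp add: mult_nonneg_nonneg\<close>)
qed

text \<open>The counters are capped at \<open>M + 1\<close>, so the sum \<open>k * (M + 1)\<close>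
  forces every one of them to be full, and by the choice of \<open>M\<close> every cluster is then
  settled.\<close>

lemma pot_full:
  assumes M: "(1 - e / 4) ^ M * (16 / e)\<^sup>2 \<le> (e / 2)\<^sup>2"
    and "pot M X (k * (M + 1))"
  shows "(\<Sum>p<n. w X p) \<le> (1 + e) * (\<Sum>p<n. v p)"
proof (rule all_settled_mass)
  fix j assume j: "j < k"
  obtain c where c: "(\<Sum>j<k. c j) = k * (M + 1)" "\<And>j. j < k \<Longrightarrow> c j \<le> M + 1"
    "\<And>j. j < k \<Longrightarrow> 0 < c j \<Longrightarrow> (\<Delta> (X j) (opt j))\<^sup>2 \<le> (1 - e / 4) ^ (c j - 1) * (16 / e * scale j)\<^sup>2"
    using assms(2) unfolding pot_def by metis
  have "c j = M + 1"
  proof (rule ccontr)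
    assume "c j \<noteq> M + 1"
    then have "(\<Sum>j<k. c j) < (\<Sum>j<k. M + 1)"
      using c(2) j by (intro sum_strict_mono_ex1) (auto simp: le_less)
    then show False using c(1) by simp
  qed
  then show "settled X j" using c(3)[OF j] by (intro settledI[OF M]) auto
qed

text \<open>By the interpolation identity the new squared distance is \<open>1 - e / 4\<close> times
  the old one plus \<open>e / 4\<close> times the difference of \<open>x\<^sup>2\<close> and
  \<open>(1 - e / 4) * y\<^sup>2\<close>. This difference is not positive, as
  \<open>(1 + e / 2) * x \<le> y\<close> and
  \<open>1 \<le> (1 - e / 4) * (1 + e / 2)\<^sup>2\<close>.\<close>

lemma contract:
  assumes "witness X p" "ctr p = j"
  shows "(\<Delta> (\<lambda>i. (1 - e / 4) * X j i + e / 4 * pt p i) (opt j))\<^sup>2 \<le> (1 - e / 4) * (\<Delta> (X j) (opt j))\<^sup>2"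
proof -
  define x where "x = \<Delta> (pt p) (opt j)"
  define y where "y = \<Delta> (X j) (pt p)"
  have "j < k" using ctr assms by auto
  then have "(1 + e / 2) * x \<le> y"
    using witness_far[OF assms(1)] near_le[of j k d X "pt p"]
    by (simp add: assms(2) x_def y_def euclid_dist_commute)
  moreover have "0 \<le> x" by (simp add: x_def euclid_dist_nonneg)
  ultimately have "((1 + e / 2) * x)\<^sup>2 \<le> y\<^sup>2" using e by (intro power_mono) auto
  then have "(1 - e / 4) * ((1 + e / 2)\<^sup>2 * x\<^sup>2) \<le> (1 - e / 4) * y\<^sup>2"
    using e by (intro mult_left_mono) (auto simp: power_mult_distrib)
  moreover have "1 * x\<^sup>2 \<le> ((1 - e / 4) * (1 + e / 2)\<^sup>2) * x\<^sup>2"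
  proof (rule mult_right_mono)
    have "e * (e * e) \<le> e * 1" using e by (intro mult_left_mono) (auto intro: mult_le_one)
    then show "1 \<le> (1 - e / 4) * (1 + e / 2)\<^sup>2"
      using e by (simp add: power2_eq_square field_simps)
  qed simp
  ultimately have "x\<^sup>2 \<le> (1 - e / 4) * y\<^sup>2" by (simp add: mult.assoc)
  then have "e / 4 * x\<^sup>2 \<le> e / 4 * ((1 - e / 4) * y\<^sup>2)" using e by (intro mult_left_mono) auto
  then show ?thesis unfolding euclid_dist_interpolate x_def y_def by simp
qed

text \<open>Only the center of the cluster of \<open>p\<close> moves, and its counter can still
  grow: a full one would mean a settled cluster. A jump never destroys progress, because a positive
  counter makes the center close, and then the move is a step.\<close>

lemma pot_step:
  assumes M: "(1 - e / 4) ^ M * (16 / e)\<^sup>2 \<le> (e / 2)\<^sup>2"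
    and pot: "pot M X m" and p: "p \<in> useful X"
  obtains u where "u < 2 * k" "pot M (improve X (pt p) u) (Suc m)"
proof -
  obtain c where c: "(\<Sum>j<k. c j) = m" "\<And>j. j < k \<Longrightarrow> c j \<le> M + 1"
    "\<And>j. j < k \<Longrightarrow> 0 < c j \<Longrightarrow> (\<Delta> (X j) (opt j))\<^sup>2 \<le> (1 - e / 4) ^ (c j - 1) * (16 / e * scale j)\<^sup>2"
    using pot unfolding pot_def by metis
  define j where "j = ctr p"
  have j: "j < k" using ctr by (simp add: j_def)
  have nf: "\<not> settled X j" using p by (simp add: useful_def j_def)
  have cj: "c j \<le> M"
    using nf c(3)[OF j] c(2)[OF j] settledI[OF M, of X j] by (cases "c j = M + 1") auto
  define u where "u = (if close X j then j else k + j)"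
  define Y where "Y = improve X (pt p) u"
  have Y: "Y i = X i" if "i \<noteq> j" for i
    using that j by (auto simp: Y_def u_def improve_def)
  have Yj: "(\<Delta> (Y j) (opt j))\<^sup>2 \<le> (1 - e / 4) ^ c j * (16 / e * scale j)\<^sup>2"
  proof (cases "close X j")
    case True
    then have "(\<Delta> (Y j) (opt j))\<^sup>2 \<le> (1 - e / 4) * (\<Delta> (X j) (opt j))\<^sup>2"
      using contract[of X p j] p j by (simp add: Y_def u_def improve_def useful_def j_def)
    also have "\<dots> \<le> (1 - e / 4) ^ c j * (16 / e * scale j)\<^sup>2"
    proof (cases "c j")
      case 0
      have "(\<Delta> (X j) (opt j))\<^sup>2 \<le> (16 / e * scale j)\<^sup>2"
        using True by (intro power_mono) (auto simp: close_def euclid_dist_nonneg)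
      moreover have "(1 - e / 4) * (\<Delta> (X j) (opt j))\<^sup>2 \<le> 1 * (\<Delta> (X j) (opt j))\<^sup>2"
        using e by (intro mult_right_mono) auto
      ultimately show ?thesis using 0 by simp
    next
      case (Suc l)
      then have "(\<Delta> (X j) (opt j))\<^sup>2 \<le> (1 - e / 4) ^ l * (16 / e * scale j)\<^sup>2"
        using c(3)[OF j] by simp
      then have "(1 - e / 4) * (\<Delta> (X j) (opt j))\<^sup>2 \<le> (1 - e / 4) * ((1 - e / 4) ^ l * (16 / e * scale j)\<^sup>2)"
        using e by (intro mult_left_mono) auto
      then show ?thesis using Suc by (simp add: mult.assoc)
    qed
    finally show ?thesis .
  next
    case False
    have "c j = 0"
    proof (rule ccontr)
      assume "c j \<noteq> 0"
      then have "(\<Delta> (X j) (opt j))\<^sup>2 \<le> (1 - e / 4) ^ (c j - 1) * (16 / e * scale j)\<^sup>2"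
        using c(3)[OF j] by simp
      also have "\<dots> \<le> 1 * (16 / e * scale j)\<^sup>2"
        using e by (intro mult_right_mono power_le_one) auto
      finally have "(\<Delta> (X j) (opt j))\<^sup>2 \<le> (16 / e * scale j)\<^sup>2" by simp
      then have "\<Delta> (X j) (opt j) \<le> 16 / e * scale j"
        by (rule power2_le_imp_le) (use e scale_nonneg[of j] in simp)
      then show False using False by (simp add: close_def)
    qed
    moreover have "\<Delta> (Y j) (opt j) \<le> 16 / e * scale j"
      using False p j by (simp add: Y_def u_def improve_def useful_def j_def)
    ultimately show ?thesis using euclid_dist_nonneg by (simp add: power_mono)
  qed
  have "(\<Sum>i<k. (c(j := Suc (c j))) i) = Suc m"
  proof -
    have "(\<Sum>i<k. (c(j := Suc (c j))) i) = (\<Sum>i<k. c i + (if i = j then 1 else 0))"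
      by (intro sum.cong) auto
    then show ?thesis using j c(1) by (simp add: sum.distrib)
  qed
  then have "pot M Y (Suc m)"
    unfolding pot_def using c(2,3) cj Y Yj by (intro exI[of _ "c(j := Suc (c j))"]) auto
  moreover have "u < 2 * k" using j by (auto simp: u_def)
  ultimately show thesis using that by (auto simp: Y_def)
qed

end

section \<open>The program\<close>

text \<open>Points: the clients are in the cells below \<open>n\<close>, the current centers in the \<open>k\<close> cells from \<open>n\<close> on, the
  best centers so far in the \<open>k\<close> cells from \<open>n + k\<close> on. Naturals: cell 2 holds \<open>q = \<lceil>1 / \<epsilon>\<rceil>\<close>, cell 3 the length
  of a lucky block, cell 4 the number of iterations, cell 5 the resolution of the weighted draw, cell
  6 the iteration; cells 9 and 10 hold the random numbers and cell 11 the drawn client. Reals: cell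
  2 holds the best cost so far, cell 3 the current cost, and the weights are in the cells from 16 on.\<close>

abbreviation "NC i \<equiv> NCell (NConst i)"
abbreviation "RC i \<equiv> RCell (NConst i)"
abbreviation "nset i \<equiv> NAssign (NConst i)"
abbreviation "rset i \<equiv> RAssign (NConst i)"
abbreviation "RN i \<equiv> RNat (NConst i)"
abbreviation "center j \<equiv> PCell (NAdd (NC 0) j)"

definition near_step :: com where
  "near_step = Cond (RLess (RDist (PCell (NC 7)) (center (NC 8))) (RC 4))
     (rset 4 (RDist (PCell (NC 7)) (center (NC 8)))) Skip"

definition weight_step :: com where
  "weight_step =
     Seq (rset 4 (RDist (PCell (NC 7)) (PCell (NC 0))))
    (Seq (For 8 (NC 1) near_step)
    (Seq (rset 4 (RSub (RC 4) (RMul (RAdd (RN 1) (RC 1)) (RC 0))))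
    (Seq (Cond (RLess (RC 4) (RN 0)) (rset 4 (RN 0)) Skip)
    (Seq (RAssign (NAdd (NConst 16) (NC 7)) (RC 4))
         (rset 3 (RAdd (RC 3) (RC 4)))))))"

definition weigh :: com where
  "weigh = Seq (rset 3 (RN 0)) (For 7 (NC 0) weight_step)"

text \<open>In the first iteration the recorded cost is a mere placeholder, so the current centers
  are then recorded unconditionally.\<close>

definition keep_best :: com where
  "keep_best = Cond (BAnd (NLess (NConst 0) (NC 6)) (BNot (RLess (RC 3) (RC 2)))) Skip
     (Seq (rset 2 (RC 3)) (For 8 (NC 1) (PAssign (NAdd (NAdd (NC 0) (NC 1)) (NC 8)) (center (NC 8)))))"

definition select_step :: com where
  "select_step = Seq (rset 6 (RAdd (RC 6) (RCell (NAdd (NConst 16) (NC 7)))))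
     (Cond (RLess (RC 5) (RC 6)) Skip (nset 11 (NAdd (NC 7) (NConst 1))))"

text \<open>Inverse transform sampling by a linear scan. The last client is the default and is not
  scanned, so cell 11 holds a client even if all weights are 0.\<close>

definition select :: com where
  "select =
     Seq (rset 5 (RDiv (RMul (RC 3) (RNat (NC 9))) (RNat (NAdd (NC 5) (NConst 1)))))
    (Seq (rset 6 (RN 0))
    (Seq (nset 11 (NConst 0))
         (For 7 (NSub (NC 0) (NConst 1)) select_step)))"

definition move :: com where
  "move = Cond (NLess (NC 10) (NC 1))
     (PAssign (NAdd (NC 0) (NC 10))
       (PAdd (PScale (RSub (RN 1) (RDiv (RC 1) (RN 4))) (center (NC 10)))
         (PScale (RDiv (RC 1) (RN 4)) (PCell (NC 11)))))
     (PAssign (NAdd (NC 0) (NSub (NC 10) (NC 1))) (PCell (NC 11)))"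

definition body :: com where
  "body = Seq (Seq weigh keep_best)
     (Seq (Rand (NConst 9) (NC 5))
     (Seq (Rand (NConst 10) (NSub (NAdd (NC 1) (NC 1)) (NConst 1)))
     (Seq select (Seq move (nset 6 (NAdd (NC 6) (NConst 1)))))))"

definition write_output :: com where
  "write_output = Seq (For 8 (NC 1) (PAssign (NC 8) (PCell (NAdd (NAdd (NC 0) (NC 1)) (NC 8)))))
     (nset 0 (NC 1))"

text \<open>Counting up replaces the rounding of a real to a natural number, at a cost proportional
  to the result.\<close>

definition ceil_loop :: "nat \<Rightarrow> rexp \<Rightarrow> com" where
  "ceil_loop v x = Seq (nset v (NConst 0))
     (While (RLess (RNat (NC v)) x) (nset v (NAdd (NC v) (NConst 1))))"

lemma valid_ceil_loop:
  assumes "\<And>s. P s \<Longrightarrow> rval d x s = y"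
    and upd: "\<And>s z. P s \<Longrightarrow> P (s\<lparr>nmem := (nmem s)(v := z)\<rparr>)"
    and m: "\<And>i. real i < y \<longleftrightarrow> i < m"
  shows "valid d P (ceil_loop v x) (m * 3 + 3) (\<lambda>s. P s \<and> nmem s v = m)"
proof -
  let ?I = "\<lambda>i s. P s \<and> nmem s v = i"
  have "valid d (?I 0) (While (RLess (RNat (NC v)) x) (nset v (NAdd (NC v) (NConst 1))))
      (m * (1 + 2) + 1) (?I m)"
  proof (rule valid_While)
    show "valid d (?I i) (nset v (NAdd (NC v) (NConst 1))) 1 (?I (Suc i))" for i
      by (rule valid_pre[OF valid_NAssign]) (auto intro: upd)
    show "bval d (RLess (RNat (NC v)) x) s" if "i < m" "?I i s" for i s
      using that assms(1)[of s] m[of i] by simp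
    show "\<not> bval d (RLess (RNat (NC v)) x) s" if "?I m s" for s
      using that assms(1)[of s] m[of m] by simp
  qed
  from valid_Seq[OF this valid_NAssign] show ?thesis
    unfolding ceil_loop_def by (rule valid_pre) (auto intro: upd)
qed

text \<open>Naturals cannot be multiplied, so products are computed exactly as reals and then
  converted. A block has \<open>56 * q * q + 1\<close> moves per cluster and one more iteration to
  record the result; \<open>64 * k * q\<close> bounds the inverse probability of a lucky move, and
  the factor \<open>a * n\<close> amplifies.\<close>

definition prelude :: "nat \<Rightarrow> com" where
  "prelude a =
     Seq (ceil_loop 2 (RDiv (RN 1) (RC 1)))
    (Seq (ceil_loop 3 (RAdd (RMul (RNat (NC 1))
            (RAdd (RMul (RN 56) (RMul (RNat (NC 2)) (RNat (NC 2)))) (RN 1))) (RN 1)))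
    (Seq (rset 7 (RN 1))
    (Seq (For 12 (NC 3) (rset 7 (RMul (RMul (RN 64) (RMul (RNat (NC 1)) (RNat (NC 2)))) (RC 7))))
    (Seq (ceil_loop 4 (RMul (RNat (NC 3)) (RMul (RC 7) (RMul (RN a) (RNat (NC 0))))))
         (ceil_loop 5 (RMul (RN 32) (RMul (RNat (NC 0)) (RNat (NC 2)))))))))"

definition main_loop :: com where
  "main_loop = While (NLess (NC 6) (NC 4)) body"

definition program :: "nat \<Rightarrow> com" where
  "program a = Seq (prelude a) (Seq main_loop write_output)"

text \<open>Left in the shape that \<open>valid_Seq\<close> produces, so that time bounds match
  syntactically.\<close>

abbreviation body_time :: "nat \<Rightarrow> nat \<Rightarrow> nat" where
  "body_time n k \<equiv> Suc (Suc ((n * (k * 6 + 19) + 5) + (k * 5 + 6)) + Suc (1 + Suc (1 + Suc ((n * 8 + 9) + 4))))"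

section \<open>Analysis of the main loop\<close>

context hybrid
begin

text \<open>\<open>X\<close> are the current centers, \<open>Y\<close> the best centers seen so far, and \<open>\<beta>\<close> is their cost.\<close>

definition core :: "nat \<Rightarrow> nat \<Rightarrow> nat \<Rightarrow> (nat \<Rightarrow> point) \<Rightarrow> (nat \<Rightarrow> point) \<Rightarrow> real \<Rightarrow> state \<Rightarrow> bool" where
  "core T b i X Y \<beta> s \<longleftrightarrow> nmem s 0 = n \<and> nmem s 1 = k \<and> nmem s 4 = T \<and> nmem s 5 = b \<and> nmem s 6 = i \<and>
     rmem s 0 = r \<and> rmem s 1 = e \<and> rmem s 2 = \<beta> \<and>
     (\<forall>p<n. pmem s p = pt p) \<and> (\<forall>j<k. pmem s (n + j) = X j) \<and> (\<forall>j<k. pmem s (n + k + j) = Y j)"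

definition weighed :: "(nat \<Rightarrow> point) \<Rightarrow> nat \<Rightarrow> state \<Rightarrow> bool" where
  "weighed X m s \<longleftrightarrow> rmem s 3 = (\<Sum>p<m. w X p) \<and> (\<forall>p<m. rmem s (16 + p) = w X p)"

text \<open>\<open>max 1 j\<close> reflects that cell 4 starts with the distance to center 0: round
  \<open>j = 0\<close> repeats it, and no minimum over an empty family occurs.\<close>

lemma near_step_valid:
  assumes "j < k" "p < n"
  shows "valid d
    (\<lambda>s. (core T b i X Y \<beta> s \<and> weighed X p s \<and> nmem s 7 = p \<and> rmem s 4 = near d (max 1 j) X (pt p)) \<and> nmem s 8 = j)
    near_step 2
    (\<lambda>s. (core T b i X Y \<beta> s \<and> weighed X p s \<and> nmem s 7 = p \<and> rmem s 4 = near d (max 1 (Suc j)) X (pt p)) \<and> nmem s 8 = j)"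
proof -
  have *: "near d (max 1 (Suc j)) X (pt p) = min (near d (max 1 j) X (pt p)) (euclid_dist d (pt p) (X j))"
    by (cases j) (simp_all add: near_1 near_Suc)
  show ?thesis
    unfolding near_step_def *
    by (rule valid_pre, (rule valid_Cond valid_RAssign valid_Skip)+)
      (use assms in \<open>auto simp: core_def weighed_def min_def\<close>)
qed

lemma weight_step_valid:
  assumes "p < n"
  shows "valid d (\<lambda>s. (core T b i X Y \<beta> s \<and> weighed X p s) \<and> nmem s 7 = p)
    weight_step (k * 6 + 15)
    (\<lambda>s. (core T b i X Y \<beta> s \<and> weighed X (Suc p) s) \<and> nmem s 7 = p)"
proof -
  let ?I = "\<lambda>j s. core T b i X Y \<beta> s \<and> weighed X p s \<and> nmem s 7 = p \<and> rmem s 4 = near d (max 1 j) X (pt p)"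
  let ?Q = "\<lambda>s. (core T b i X Y \<beta> s \<and> weighed X (Suc p) s) \<and> nmem s 7 = p"
  have loop: "valid d (?I 0) (For 8 (NC 1) near_step) (k * (2 + 4) + 3) (?I k)"
    using near_step_valid[OF _ assms, of _ T b i X Y \<beta>]
    by (intro valid_For) (auto simp: core_def weighed_def)
  have k': "max 1 k = k" using k by simp
  have "valid d (?I k)
     (Seq (rset 4 (RSub (RC 4) (RMul (RAdd (RN 1) (RC 1)) (RC 0))))
     (Seq (Cond (RLess (RC 4) (RN 0)) (rset 4 (RN 0)) Skip)
     (Seq (RAssign (NAdd (NConst 16) (NC 7)) (RC 4))
          (rset 3 (RAdd (RC 3) (RC 4)))))) 9 ?Q"
    unfolding k'
    by (rule valid_pre, (rule valid_Seq valid_Cond valid_RAssign valid_Skip)+)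
      (auto simp: core_def weighed_def w_def excess_def less_Suc_eq)
  note rest = valid_Seq[OF valid_Seq[OF this loop] valid_RAssign]
  show ?thesis unfolding weight_step_def
  proof (rule valid_pre[OF rest])
    fix s assume s: "(core T b i X Y \<beta> s \<and> weighed X p s) \<and> nmem s 7 = p"
    then have "pmem s n = X 0" using k unfolding core_def by (metis add_0_right less_le_trans zero_less_one)
    then show "?I 0 (s\<lparr>rmem := (rmem s)(nval (NConst 4) s :=
        rval d (RDist (PCell (NC 7)) (PCell (NC 0))) s)\<rparr>)"
      using s assms by (simp add: core_def weighed_def near_1)
  qed simp
qed

lemma weigh_valid:
  "valid d (core T b i X Y \<beta>) weigh (n * (k * 6 + 19) + 5) (\<lambda>s. core T b i X Y \<beta> s \<and> weighed X n s)"
proof -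
  have "valid d (\<lambda>s. core T b i X Y \<beta> s \<and> weighed X 0 s) (For 7 (NC 0) weight_step)
      (n * (k * 6 + 15 + 4) + 3) (\<lambda>s. core T b i X Y \<beta> s \<and> weighed X n s)"
    using weight_step_valid
    by (intro valid_For[where I = "\<lambda>p s. core T b i X Y \<beta> s \<and> weighed X p s"])
      (auto simp: core_def weighed_def)
  from valid_Seq[OF this valid_RAssign] show ?thesis unfolding weigh_def
    by (rule valid_pre) (auto simp: core_def weighed_def)
qed

lemma copy_best_valid:
  "valid d (\<lambda>s. core T b i X Y \<beta> s \<and> weighed X n s)
    (For 8 (NC 1) (PAssign (NAdd (NAdd (NC 0) (NC 1)) (NC 8)) (center (NC 8)))) (k * 5 + 3)
    (\<lambda>s. core T b i X X \<beta> s \<and> weighed X n s)"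
proof -
  let ?I = "\<lambda>j s. core T b i X (\<lambda>l. if l < j then X l else Y l) \<beta> s \<and> weighed X n s"
  have "valid d (?I 0) (For 8 (NC 1) (PAssign (NAdd (NAdd (NC 0) (NC 1)) (NC 8)) (center (NC 8))))
      (k * (1 + 4) + 3) (?I k)"
  proof (rule valid_For)
    show "valid d (\<lambda>s. ?I j s \<and> nmem s 8 = j)
        (PAssign (NAdd (NAdd (NC 0) (NC 1)) (NC 8)) (center (NC 8))) 1 (\<lambda>s. ?I (Suc j) s \<and> nmem s 8 = j)"
      if "j < k" for j
      by (rule valid_pre[OF valid_PAssign]) (use that in \<open>auto simp: core_def weighed_def\<close>)
  qed (auto simp: core_def weighed_def)
  then show ?thesis by (rule valid_conseq) (auto simp: core_def)
qed

lemma keep_best_valid: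
  fixes X Y :: "nat \<Rightarrow> point"
  assumes "keep \<longleftrightarrow> 0 < i \<and> \<beta> \<le> (\<Sum>p<n. w X p)"
  shows "valid d (\<lambda>s. core T b i X Y \<beta> s \<and> weighed X n s) keep_best (k * 5 + 6)
    (\<lambda>s. core T b i X (if keep then Y else X) (if keep then \<beta> else (\<Sum>p<n. w X p)) s \<and> weighed X n s)"
proof (cases keep)
  case True
  let ?Q = "\<lambda>s. core T b i X Y \<beta> s \<and> weighed X n s"
  \<comment> \<open>The recording branch is unreachable in this case and gets the precondition
    \<open>False\<close>.\<close>
  have "valid d (\<lambda>_. False) (Seq (rset 2 (RC 3))
      (For 8 (NC 1) (PAssign (NAdd (NAdd (NC 0) (NC 1)) (NC 8)) (center (NC 8))))) 0 ?Q"
    by (simp add: valid_def)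
  from valid_Cond[OF valid_Skip this]
  show ?thesis unfolding keep_best_def
    by (rule valid_conseq) (use assms True in \<open>auto simp: core_def weighed_def\<close>)
next
  case False
  have "valid d (\<lambda>s. core T b i X Y \<beta> s \<and> weighed X n s)
      (Seq (rset 2 (RC 3)) (For 8 (NC 1) (PAssign (NAdd (NAdd (NC 0) (NC 1)) (NC 8)) (center (NC 8)))))
      (k * 5 + 5) (\<lambda>s. core T b i X X (\<Sum>p<n. w X p) s \<and> weighed X n s)"
    by (rule valid_pre[OF valid_Seq[OF copy_best_valid valid_RAssign]]) (auto simp: core_def weighed_def)
  from valid_Cond[OF valid_Skip this]
  show ?thesis unfolding keep_best_def
    by (rule valid_conseq) (use assms False in \<open>auto simp: core_def weighed_def\<close>)
qed

text \<open>For \<open>u \<le> b\<close> the threshold is below the total weight unless that weight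
  is 0; the implication admits the default client of this case.\<close>

definition drawn :: "nat \<Rightarrow> nat \<Rightarrow> (nat \<Rightarrow> point) \<Rightarrow> nat \<Rightarrow> bool" where
  "drawn b u X p \<longleftrightarrow> p < n \<and>
     (\<Sum>q<p. w X q) \<le> (\<Sum>q<n. w X q) * real u / real (b + 1) \<and>
     ((\<Sum>q<n. w X q) * real u / real (b + 1) < (\<Sum>q<n. w X q) \<longrightarrow>
      (\<Sum>q<n. w X q) * real u / real (b + 1) < (\<Sum>q<Suc p. w X q))"

lemma select_valid:
  assumes n: "1 \<le> n"
  shows "valid d (\<lambda>s. core T b i X Y \<beta> s \<and> weighed X n s \<and> nmem s 9 = u \<and> nmem s 10 = x)
    select (n * 8 + 9) (\<lambda>s. core T b i X Y \<beta> s \<and> nmem s 10 = x \<and> drawn b u X (nmem s 11))"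
proof -
  define t where "t = (\<Sum>q<n. w X q) * real u / real (b + 1)"
  define S where "S p = (\<Sum>q<p. w X q)" for p
  have t0: "0 \<le> t" unfolding t_def by (intro divide_nonneg_nonneg mult_nonneg_nonneg sum_nonneg w_nonneg) auto
  \<comment> \<open>Cell 11 is the first client whose prefix sum exceeds \<open>t\<close>, or
    \<open>m\<close> if there is none among those scanned so far.\<close>
  let ?I = "\<lambda>m s. core T b i X Y \<beta> s \<and> weighed X n s \<and> nmem s 10 = x \<and> rmem s 5 = t \<and> rmem s 6 = S m \<and>
    nmem s 11 \<le> m \<and> S (nmem s 11) \<le> t \<and> (nmem s 11 = m \<or> t < S (Suc (nmem s 11)))"
  have loop: "valid d (?I 0) (For 7 (NSub (NC 0) (NConst 1)) select_step) ((n - 1) * (4 + 4) + 3) (?I (n - 1))"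
  proof (rule valid_For)
    show "valid d (\<lambda>s. ?I m s \<and> nmem s 7 = m) select_step 4 (\<lambda>s. ?I (Suc m) s \<and> nmem s 7 = m)"
      if "m < n - 1" for m
    proof -
      have m: "m < n" using that by simp
      show ?thesis
        unfolding select_step_def
        by (rule valid_pre, (rule valid_Seq valid_Cond valid_NAssign valid_RAssign valid_Skip)+)
          (use m in \<open>auto simp: core_def weighed_def S_def le_less\<close>)
    qed
  qed (auto simp: core_def weighed_def)
  have post: "core T b i X Y \<beta> s \<and> nmem s 10 = x \<and> drawn b u X (nmem s 11)" if "?I (n - 1) s" for s
  proof -
    have "t < S (Suc (nmem s 11))" if "t < S n"
      using \<open>?I (n - 1) s\<close> that n by (cases "nmem s 11 = n - 1") auto
    then show ?thesis using that n by (auto simp: drawn_def S_def t_def)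
  qed
  have "valid d (?I 0) (For 7 (NSub (NC 0) (NConst 1)) select_step) ((n - 1) * (4 + 4) + 3)
    (\<lambda>s. core T b i X Y \<beta> s \<and> nmem s 10 = x \<and> drawn b u X (nmem s 11))"
    by (rule valid_conseq[OF loop _ post order_refl])
  from valid_Seq[OF valid_Seq[OF valid_Seq[OF this valid_NAssign] valid_RAssign] valid_RAssign]
  show ?thesis unfolding select_def
    by (rule valid_pre) (use t0 n in \<open>auto simp: core_def weighed_def S_def t_def add.commute\<close>)
qed

lemma move_valid:
  assumes "x < 2 * k" "p < n"
  shows "valid d (\<lambda>s. core T b i X Y \<beta> s \<and> nmem s 10 = x \<and> nmem s 11 = p)
    (Seq move (nset 6 (NAdd (NC 6) (NConst 1)))) 4
    (core T b (Suc i) (improve X (pt p) x) Y \<beta>)"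
  unfolding move_def
  by (rule valid_pre, (rule valid_Seq valid_Cond valid_NAssign valid_PAssign)+)
    (use assms in \<open>auto simp: core_def improve_def\<close>)

lemma write_output_valid:
  "valid d (core T b i X Y \<beta>) write_output (k * 5 + 5) (\<lambda>s. output_set s = Y ` {..<k})"
proof -
  let ?I = "\<lambda>j s. nmem s 0 = n \<and> nmem s 1 = k \<and> (\<forall>l<k. pmem s (n + k + l) = Y l) \<and> (\<forall>l<j. pmem s l = Y l)"
  have "valid d (?I 0) (For 8 (NC 1) (PAssign (NC 8) (PCell (NAdd (NAdd (NC 0) (NC 1)) (NC 8)))))
      (k * (1 + 4) + 3) (?I k)"
  proof (rule valid_For)
    show "valid d (\<lambda>s. ?I j s \<and> nmem s 8 = j)
        (PAssign (NC 8) (PCell (NAdd (NAdd (NC 0) (NC 1)) (NC 8)))) 1 (\<lambda>s. ?I (Suc j) s \<and> nmem s 8 = j)"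
      if "j < k" for j
      by (rule valid_pre[OF valid_PAssign]) (use that in \<open>auto simp: less_Suc_eq\<close>)
  qed auto
  then have "valid d (core T b i X Y \<beta>) (For 8 (NC 1) (PAssign (NC 8) (PCell (NAdd (NAdd (NC 0) (NC 1)) (NC 8)))))
      (k * (1 + 4) + 3) (\<lambda>s. nmem s 1 = k \<and> (\<forall>l<k. pmem s l = Y l))"
    by (rule valid_conseq) (auto simp: core_def)
  then have "valid d (core T b i X Y \<beta>) (For 8 (NC 1) (PAssign (NC 8) (PCell (NAdd (NAdd (NC 0) (NC 1)) (NC 8)))))
      (k * (1 + 4) + 3) (\<lambda>s. output_set (s\<lparr>nmem := (nmem s)(nval (NConst 0) s := nval (NC 1) s)\<rparr>) = Y ` {..<k})"
    by (rule valid_conseq) (auto simp: output_set_def image_iff)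
  from valid_Seq[OF valid_NAssign this] show ?thesis unfolding write_output_def
    by (rule valid_pre) auto
qed

definition best :: "nat \<Rightarrow> (nat \<Rightarrow> point) \<Rightarrow> (nat \<Rightarrow> point) \<Rightarrow> real \<Rightarrow> nat \<Rightarrow> point" where
  "best i X Y \<beta> = (if 0 < i \<and> \<beta> \<le> (\<Sum>p<n. w X p) then Y else X)"

definition best_cost :: "nat \<Rightarrow> (nat \<Rightarrow> point) \<Rightarrow> real \<Rightarrow> real" where
  "best_cost i X \<beta> = (if 0 < i \<and> \<beta> \<le> (\<Sum>p<n. w X p) then \<beta> else (\<Sum>p<n. w X p))"

lemma evaluate_valid:
  "valid d (core T b i X Y \<beta>) (Seq weigh keep_best) (Suc ((n * (k * 6 + 19) + 5) + (k * 5 + 6)))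
    (\<lambda>s. core T b i X (best i X Y \<beta>) (best_cost i X \<beta>) s \<and> weighed X n s)"
  unfolding best_def best_cost_def by (rule valid_Seq[OF keep_best_valid[OF refl] weigh_valid])

lemma update_valid:
  assumes "1 \<le> n" "x < 2 * k"
  shows "valid d (\<lambda>s. core T b i X Y \<beta> s \<and> weighed X n s \<and> nmem s 9 = u \<and> nmem s 10 = x)
    (Seq select (Seq move (nset 6 (NAdd (NC 6) (NConst 1))))) (Suc ((n * 8 + 9) + 4))
    (\<lambda>s. \<exists>p. drawn b u X p \<and> core T b (Suc i) (improve X (pt p) x) Y \<beta> s)"
proof -
  have "valid d (\<lambda>s. \<exists>p. drawn b u X p \<and> core T b i X Y \<beta> s \<and> nmem s 10 = x \<and> nmem s 11 = p)
      (Seq move (nset 6 (NAdd (NC 6) (NConst 1)))) 4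
      (\<lambda>s. \<exists>p. drawn b u X p \<and> core T b (Suc i) (improve X (pt p) x) Y \<beta> s)"
  proof (rule valid_ex)
    fix p
    show "valid d (\<lambda>s. drawn b u X p \<and> core T b i X Y \<beta> s \<and> nmem s 10 = x \<and> nmem s 11 = p)
        (Seq move (nset 6 (NAdd (NC 6) (NConst 1)))) 4
        (\<lambda>s. \<exists>p. drawn b u X p \<and> core T b (Suc i) (improve X (pt p) x) Y \<beta> s)"
    proof (cases "drawn b u X p")
      case True
      then have "p < n" by (simp add: drawn_def)
      from move_valid[OF assms(2) this] show ?thesis
        by (rule valid_conseq) (use True in auto)
    qed (simp add: valid_def)
  qed
  moreover have "valid d (\<lambda>s. core T b i X Y \<beta> s \<and> weighed X n s \<and> nmem s 9 = u \<and> nmem s 10 = x)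
      select (n * 8 + 9) (\<lambda>s. \<exists>p. drawn b u X p \<and> core T b i X Y \<beta> s \<and> nmem s 10 = x \<and> nmem s 11 = p)"
    by (rule valid_conseq[OF select_valid[OF assms(1), of T b i X Y \<beta> u x]]) auto
  ultimately show ?thesis by (rule valid_Seq)
qed

lemma draw_update_valid:
  assumes n: "1 \<le> n"
  shows "valid d (\<lambda>s. core T b i X Y \<beta> s \<and> weighed X n s \<and> nmem s 9 \<le> b)
    (Seq (Rand (NConst 10) (NSub (NAdd (NC 1) (NC 1)) (NConst 1)))
      (Seq select (Seq move (nset 6 (NAdd (NC 6) (NConst 1))))))
    (Suc (1 + Suc ((n * 8 + 9) + 4)))
    (\<lambda>s. \<exists>p x. p < n \<and> x < 2 * k \<and> core T b (Suc i) (improve X (pt p) x) Y \<beta> s)"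
proof (rule valid_pre[OF valid_Seq[OF _ valid_Rand]])
  show "valid d (\<lambda>s. \<exists>x. x < 2 * k \<and> (\<exists>u. core T b i X Y \<beta> s \<and> weighed X n s \<and> nmem s 9 = u \<and> nmem s 10 = x))
      (Seq select (Seq move (nset 6 (NAdd (NC 6) (NConst 1))))) (Suc ((n * 8 + 9) + 4))
      (\<lambda>s. \<exists>p x. p < n \<and> x < 2 * k \<and> core T b (Suc i) (improve X (pt p) x) Y \<beta> s)"
  proof (rule valid_ex)
    fix x
    show "valid d (\<lambda>s. x < 2 * k \<and> (\<exists>u. core T b i X Y \<beta> s \<and> weighed X n s \<and> nmem s 9 = u \<and> nmem s 10 = x))
      (Seq select (Seq move (nset 6 (NAdd (NC 6) (NConst 1))))) (Suc ((n * 8 + 9) + 4))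
      (\<lambda>s. \<exists>p x. p < n \<and> x < 2 * k \<and> core T b (Suc i) (improve X (pt p) x) Y \<beta> s)"
    proof (cases "x < 2 * k")
      case True
      have "valid d (\<lambda>s. \<exists>u. core T b i X Y \<beta> s \<and> weighed X n s \<and> nmem s 9 = u \<and> nmem s 10 = x)
        (Seq select (Seq move (nset 6 (NAdd (NC 6) (NConst 1))))) (Suc ((n * 8 + 9) + 4))
        (\<lambda>s. \<exists>p x. p < n \<and> x < 2 * k \<and> core T b (Suc i) (improve X (pt p) x) Y \<beta> s)"
        by (rule valid_ex, rule valid_conseq[OF update_valid[OF n True]])
          (use True in \<open>auto simp: drawn_def\<close>)
      then show ?thesis by (rule valid_pre) auto
    qed (simp add: valid_def)
  qed
  show "\<forall>m\<le>nval (NSub (NAdd (NC 1) (NC 1)) (NConst 1)) s. \<exists>x<2 * k. \<exists>u.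
      core T b i X Y \<beta> (s\<lparr>nmem := (nmem s)(nval (NConst 10) s := m)\<rparr>) \<and>
      weighed X n (s\<lparr>nmem := (nmem s)(nval (NConst 10) s := m)\<rparr>) \<and>
      nmem (s\<lparr>nmem := (nmem s)(nval (NConst 10) s := m)\<rparr>) 9 = u \<and>
      nmem (s\<lparr>nmem := (nmem s)(nval (NConst 10) s := m)\<rparr>) 10 = x"
    if "core T b i X Y \<beta> s \<and> weighed X n s \<and> nmem s 9 \<le> b" for s
    using that k by (auto simp: core_def weighed_def)
qed simp

lemma draw_valid:
  "valid d (\<lambda>s. core T b i X Y \<beta> s \<and> weighed X n s) (Rand (NConst 9) (NC 5)) 1
    (\<lambda>s. core T b i X Y \<beta> s \<and> weighed X n s \<and> nmem s 9 \<le> b)"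
  by (rule valid_pre[OF valid_Rand]) (auto simp: core_def weighed_def)

lemma body_valid:
  assumes "1 \<le> n"
  shows "valid d (core T b i X Y \<beta>) body (body_time n k)
    (\<lambda>s. \<exists>p x. p < n \<and> x < 2 * k \<and>
      core T b (Suc i) (improve X (pt p) x) (best i X Y \<beta>) (best_cost i X \<beta>) s)"
  unfolding body_def by (intro valid_Seq[OF valid_Seq[OF draw_update_valid[OF assms] draw_valid] evaluate_valid])

text \<open>\<open>H\<close> collects the favourable values of the weighted draw, and
  \<open>f u\<close> is the move that helps after the value \<open>u\<close>. The two draws are
  independent, hence the product.\<close>

lemma body_prob:
  assumes n: "1 \<le> n" and s: "core T b i X Y \<beta> s"
    and H: "H \<subseteq> {0..b}" "\<And>u. u \<in> H \<Longrightarrow> f u < 2 * k"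
    and Q: "\<And>u p s. u \<in> H \<Longrightarrow> drawn b u X p \<Longrightarrow>
      core T b (Suc i) (improve X (pt p) (f u)) (best i X Y \<beta>) (best_cost i X \<beta>) s \<Longrightarrow> Q s"
  shows "real (card H) / (real b + 1) * (1 / (2 * real k))
    \<le> measure_pmf.prob (run d (body_time n k) (body, s)) {cs. Q (snd cs)}"
proof -
  let ?Y = "best i X Y \<beta>" and ?\<beta> = "best_cost i X \<beta>"
  let ?R = "\<lambda>s. core T b i X ?Y ?\<beta> s \<and> weighed X n s"
  let ?c = "Seq select (Seq move (nset 6 (NAdd (NC 6) (NConst 1))))"
  let ?d10 = "Rand (NConst 10) (NSub (NAdd (NC 1) (NC 1)) (NConst 1))"
  have last: "1 / (2 * real k) * 1 \<le> measure_pmf.prob (run d (Suc (1 + Suc ((n * 8 + 9) + 4)))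
      (Seq ?d10 ?c, s')) {cs. Q (snd cs)}" if s': "?R s' \<and> nmem s' 9 \<le> b" "nmem s' 9 \<in> H" for s'
  proof (rule prob_Seq)
    define u where "u = nmem s' 9"
    let ?S = "\<lambda>s. ?R s \<and> nmem s 9 = u \<and> nmem s 10 < 2 * k"
    show "valid d (\<lambda>s. ?R s \<and> nmem s 9 = u) ?d10 1 ?S"
      by (rule valid_pre[OF valid_Rand]) (use k in \<open>auto simp: core_def weighed_def\<close>)
    have "valid d (\<lambda>s. \<exists>x. x < 2 * k \<and> (?R s \<and> nmem s 9 = u \<and> nmem s 10 = x)) ?c
        (Suc ((n * 8 + 9) + 4)) (\<lambda>_. True)"
    proof (rule valid_ex)
      show "valid d (\<lambda>s. x < 2 * k \<and> (?R s \<and> nmem s 9 = u \<and> nmem s 10 = x)) ?c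
          (Suc ((n * 8 + 9) + 4)) (\<lambda>_. True)" for x
      proof (cases "x < 2 * k")
        case True
        show ?thesis
          by (rule valid_conseq[OF update_valid[OF n True, of T b i X ?Y ?\<beta> u]]) auto
      qed (simp add: valid_def)
    qed
    then show "valid d ?S ?c (Suc ((n * 8 + 9) + 4)) (\<lambda>_. True)"
      by (rule valid_pre) auto
    show "?R s' \<and> nmem s' 9 = u" using s' by (simp add: u_def)
    have "real (card {f u}) / (real (nval (NSub (NAdd (NC 1) (NC 1)) (NConst 1)) s') + 1)
        \<le> measure_pmf.prob (run d 1 (?d10, s')) {cs. nmem (snd cs) 9 = u \<and> nmem (snd cs) 10 = f u}"
      using s' H(2)[of u] by (intro prob_Rand) (auto simp: core_def u_def)
    moreover have "real (nval (NSub (NAdd (NC 1) (NC 1)) (NConst 1)) s') + 1 = 2 * real k"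
      using s' k by (auto simp: core_def of_nat_diff)
    ultimately show "1 / (2 * real k) \<le> measure_pmf.prob (run d 1 (?d10, s'))
        {cs. nmem (snd cs) 9 = u \<and> nmem (snd cs) 10 = f u}" by simp
    have fin: "valid d (\<lambda>s. core T b i X ?Y ?\<beta> s \<and> weighed X n s \<and> nmem s 9 = u \<and> nmem s 10 = f u) ?c
        (Suc ((n * 8 + 9) + 4)) Q"
      by (rule valid_conseq[OF update_valid[OF n H(2)[of u]]]) (use s'(2) Q in \<open>auto simp: u_def\<close>)
    show "1 \<le> measure_pmf.prob (run d (Suc ((n * 8 + 9) + 4)) (?c, s'')) {cs. Q (snd cs)}"
      if "?S s''" "nmem s'' 9 = u \<and> nmem s'' 10 = f u" for s''
      using that by (intro prob_valid[OF fin]) auto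
  qed simp
  have "real (card H) / (real b + 1) * (1 / (2 * real k) * 1) \<le> measure_pmf.prob
      (run d (Suc (1 + Suc (1 + Suc ((n * 8 + 9) + 4)))) (Seq (Rand (NConst 9) (NC 5)) (Seq ?d10 ?c), s'))
      {cs. Q (snd cs)}" if s': "?R s'" for s'
  proof (rule prob_Seq[OF draw_valid draw_update_valid[OF n]])
    show "?R s'" by (fact s')
    show "real (card H) / (real b + 1)
        \<le> measure_pmf.prob (run d 1 (Rand (NConst 9) (NC 5), s')) {cs. nmem (snd cs) 9 \<in> H}"
      using prob_Rand[of H "NC 5" s' "\<lambda>s. nmem s 9 \<in> H" "NConst 9"] s' H(1) by (simp add: core_def)
  qed (use last in auto)
  then have "1 * (real (card H) / (real b + 1) * (1 / (2 * real k) * 1))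
      \<le> measure_pmf.prob (run d (body_time n k) (body, s)) {cs. Q (snd cs)}"
    unfolding body_def
    by (intro prob_Seq[OF evaluate_valid valid_Seq[OF draw_update_valid[OF n] draw_valid] s
          prob_valid[OF evaluate_valid s]]) auto
  then show ?thesis by simp
qed

section \<open>Levels of progress along the iterations\<close>

lemma improve_euclid:
  assumes "\<And>j. j < k \<Longrightarrow> X j \<in> euclid d" "p \<in> euclid d" "j < k"
  shows "improve X p u j \<in> euclid d"
  using assms by (auto simp: improve_def euclid_eq)

abbreviation "W X \<equiv> (\<Sum>p<n. w X p)"
abbreviation "V \<equiv> (\<Sum>p<n. v p)"

definition admissible :: "nat \<Rightarrow> (nat \<Rightarrow> point) \<Rightarrow> (nat \<Rightarrow> point) \<Rightarrow> real \<Rightarrow> bool" where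
  "admissible i X Y \<beta> \<longleftrightarrow> (\<forall>j<k. X j \<in> euclid d \<and> Y j \<in> euclid d) \<and> (0 < i \<longrightarrow> \<beta> = W Y)"

definition inv :: "nat \<Rightarrow> nat \<Rightarrow> nat \<Rightarrow> state \<Rightarrow> bool" where
  "inv T b i s \<longleftrightarrow> (\<exists>X Y \<beta>. core T b i X Y \<beta> s \<and> admissible i X Y \<beta>)"

text \<open>Level \<open>k (M + 1) + 1\<close> can only be reached through the first alternative, i.e. when good centers
  have been recorded.\<close>

definition level :: "nat \<Rightarrow> nat \<Rightarrow> nat \<Rightarrow> nat \<Rightarrow> state \<Rightarrow> bool" where
  "level T b M m s \<longleftrightarrow> (\<exists>i X Y \<beta>. core T b i X Y \<beta> s \<and> admissible i X Y \<beta> \<and>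
     (0 < i \<and> \<beta> \<le> (1 + e) * V \<or> m \<le> k * (M + 1) \<and> pot M X m))"

lemma admissible_step:
  assumes "admissible i X Y \<beta>" "p \<in> euclid d"
  shows "admissible (Suc i) (improve X p u) (best i X Y \<beta>) (best_cost i X \<beta>)"
  using assms improve_euclid[of X p _ u] by (auto simp: admissible_def best_def best_cost_def)

text \<open>The intervals between prefix sums are disjoint, so the program selects exactly the
  client to which the counting argument attributes \<open>u\<close>.\<close>

lemma drawn_unique:
  assumes "drawn b u X p" "u \<le> b" "0 < W X" "p' < n"
    and "(\<Sum>q<p'. w X q) \<le> W X * real u / real (b + 1)"
    and "W X * real u / real (b + 1) < (\<Sum>q<Suc p'. w X q)"
  shows "p = p'"
proof -
  have mono: "(\<Sum>q<Suc x. w X q) \<le> (\<Sum>q<y. w X q)" if "x < y" for x y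
    using that by (intro sum_mono2 w_nonneg) auto
  have "W X * real u < W X * real (b + 1)"
    using assms(2,3) by (intro mult_strict_left_mono) auto
  then have "W X * real u / real (b + 1) < W X" by (simp only: pos_divide_less_eq of_nat_0_less_iff zero_less_Suc Suc_eq_plus1[symmetric])
  then have "W X * real u / real (b + 1) < (\<Sum>q<Suc p. w X q)"
    "(\<Sum>q<p. w X q) \<le> W X * real u / real (b + 1)"
    using assms(1) unfolding drawn_def by blast+
  then show ?thesis using mono[of p p'] mono[of p' p] assms(5,6)
    by (cases p p' rule: linorder_cases) (fastforce+)
qed

context
  fixes T b M :: nat and \<delta> :: real
  assumes n: "1 \<le> n" and pt: "\<And>p. p < n \<Longrightarrow> pt p \<in> euclid d"
    and M: "(1 - e / 4) ^ M * (16 / e)\<^sup>2 \<le> (e / 2)\<^sup>2"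
    and b: "32 * real n / e \<le> real (b + 1)"
    and delta: "0 \<le> \<delta>" "\<delta> \<le> e / (64 * real k)"
begin

lemma inv_step: "valid d (inv T b i) body (body_time n k) (inv T b (Suc i))"
proof (rule validI)
  fix s assume "inv T b i s"
  then obtain X Y \<beta> where s: "core T b i X Y \<beta> s" "admissible i X Y \<beta>" by (auto simp: inv_def)
  show "halts_within d (body_time n k) (body, s)" using validD(1)[OF body_valid[OF n] s(1)] .
  fix cs assume "cs \<in> set_pmf (run d (body_time n k) (body, s))"
  from validD(2)[OF body_valid[OF n] s(1) this] show "inv T b (Suc i) (snd cs)"
    using admissible_step[OF s(2)] pt unfolding inv_def by blast
qed

text \<open>Recording keeps the smaller cost, so if the current or the recorded centers are good,
  then good ones are recorded after the iteration; this counts as every level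
  \<open>m\<close>.\<close>

lemma best_step:
  assumes "core T b i X Y \<beta> s" "admissible i X Y \<beta>"
    and "0 < i \<and> \<beta> \<le> (1 + e) * V \<or> W X \<le> (1 + e) * V"
    and "cs \<in> set_pmf (run d (body_time n k) (body, s))"
  shows "level T b M m (snd cs)"
proof -
  obtain p x where "p < n" "core T b (Suc i) (improve X (pt p) x) (best i X Y \<beta>) (best_cost i X \<beta>) (snd cs)"
    using validD(2)[OF body_valid[OF n] assms(1,4)] by blast
  moreover have "best_cost i X \<beta> \<le> (1 + e) * V" using assms(3) by (auto simp: best_cost_def)
  ultimately show ?thesis
    using admissible_step[OF assms(2)] pt unfolding level_def by blast
qed

lemma prob_best_step:
  assumes "core T b i X Y \<beta> s" "admissible i X Y \<beta>"
    and "0 < i \<and> \<beta> \<le> (1 + e) * V \<or> W X \<le> (1 + e) * V"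
  shows "\<delta> \<le> measure_pmf.prob (run d (body_time n k) (body, s)) {cs. level T b M m (snd cs)}"
proof -
  have "1 \<le> measure_pmf.prob (run d (body_time n k) (body, s)) {cs. level T b M m (snd cs)}"
    using best_step[OF assms] validD(1)[OF body_valid[OF n] assms(1)]
    by (intro prob_valid[of d "\<lambda>s'. s' = s"] validI) auto
  moreover have "e / (64 * real k) \<le> 1" using e k by (simp add: field_simps)
  ultimately show ?thesis using delta by linarith
qed

text \<open>If good centers are present, the level rises surely. Otherwise useful clients carry the
  share \<open>e / 16\<close> of the weight, the grid preserves half of it, and one of
  \<open>2 * k\<close> moves is right; together this is \<open>e / (64 * k)\<close>.\<close>

lemma level_step:
  assumes s: "level T b M m s" and m: "m < k * (M + 1) + 1"
  shows "\<delta> \<le> measure_pmf.prob (run d (body_time n k) (body, s)) {cs. level T b M (Suc m) (snd cs)}"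
proof -
  obtain i X Y \<beta> where c: "core T b i X Y \<beta> s" "admissible i X Y \<beta>"
    "0 < i \<and> \<beta> \<le> (1 + e) * V \<or> m \<le> k * (M + 1) \<and> pot M X m"
    using s unfolding level_def by blast
  show ?thesis
  proof (cases "0 < i \<and> \<beta> \<le> (1 + e) * V \<or> W X \<le> (1 + e) * V")
    case True
    then show ?thesis by (rule prob_best_step[OF c(1,2)])
  next
    case False
    then have pot: "pot M X m" and WV: "(1 + e) * V < W X" using c(3) by auto
    \<comment> \<open>At potential \<open>k * (M + 1)\<close> the current centers would be good by
      \<open>pot_full\<close>, so the last level is gained by recording them.\<close>
    have m': "m < k * (M + 1)"
      using pot_full[OF M, of X] pot WV c(3) False by (cases "m = k * (M + 1)") auto
    have "0 \<le> (1 + e) * V" using e by (intro mult_nonneg_nonneg sum_nonneg v_nonneg) auto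
    then have W0: "0 < W X" using WV by linarith
    define H where "H = {u \<in> {0..b}. \<exists>p\<in>useful X. (\<Sum>q<p. w X q) \<le> W X * real u / real (b + 1) \<and>
      W X * real u / real (b + 1) < (\<Sum>q<Suc p. w X q)}"
    have "2 * real n \<le> e / 16 * real (b + 1)"
      using b e by (simp add: field_simps)
    then have H: "e / 16 / 2 * real (b + 1) \<le> real (card H)"
      unfolding H_def using useful_mass[OF WV]
      by (intro card_sample_set[OF w_nonneg _ refl W0]) (auto simp: useful_def)
    have ex: "\<exists>x<2 * k. \<forall>p. drawn b u X p \<longrightarrow> pot M (improve X (pt p) x) (Suc m)" if u: "u \<in> H" for u
    proof -
      obtain p' where p': "p' \<in> useful X" "(\<Sum>q<p'. w X q) \<le> W X * real u / real (b + 1)"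
        "W X * real u / real (b + 1) < (\<Sum>q<Suc p'. w X q)" "u \<le> b"
        using u by (auto simp: H_def)
      obtain x where "x < 2 * k" "pot M (improve X (pt p') x) (Suc m)"
        using pot_step[OF M pot p'(1)] .
      moreover have "p = p'" if "drawn b u X p" for p
        using drawn_unique[OF that p'(4) W0 _ p'(2,3)] p'(1) by (simp add: useful_def)
      ultimately show ?thesis by blast
    qed
    then obtain f where f: "\<And>u. u \<in> H \<Longrightarrow> f u < 2 * k"
      "\<And>u p. u \<in> H \<Longrightarrow> drawn b u X p \<Longrightarrow> pot M (improve X (pt p) (f u)) (Suc m)"
      by metis
    have "e / (64 * real k) = e / 16 / 2 * real (b + 1) / (real b + 1) * (1 / (2 * real k))"
    proof -
      have "e / 16 / 2 * (real b + 1) / (real b + 1) = e / 16 / 2"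
        by (rule nonzero_mult_div_cancel_right) linarith
      then show ?thesis by (simp only: of_nat_add of_nat_1) simp
    qed
    also have "\<dots> \<le> real (card H) / (real b + 1) * (1 / (2 * real k))"
      using H by (intro mult_right_mono divide_right_mono) auto
    also have "\<dots> \<le> measure_pmf.prob (run d (body_time n k) (body, s)) {cs. level T b M (Suc m) (snd cs)}"
    proof (rule body_prob[OF n c(1)])
      show "level T b M (Suc m) s'" if u: "u \<in> H" and p: "drawn b u X p"
        and c': "core T b (Suc i) (improve X (pt p) (f u)) (best i X Y \<beta>) (best_cost i X \<beta>) s'" for u p s'
      proof -
        have "pt p \<in> euclid d" using p pt by (simp add: drawn_def)
        then show ?thesis
          using c' f(2)[OF u p] admissible_step[OF c(2)] m' unfolding level_def Suc_le_eq by blast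
      qed
    qed (use f in \<open>auto simp: H_def\<close>)
    finally show ?thesis using delta by linarith
  qed
qed

definition kernel :: "state \<Rightarrow> state pmf" where
  "kernel s = map_pmf snd (run d (body_time n k) (body, s))"

lemma prob_kernel: "measure_pmf.prob (kernel s) {s. Q s} = measure_pmf.prob (run d (body_time n k) (body, s)) {cs. Q (snd cs)}"
  by (simp add: kernel_def vimage_def)

lemma main_loop_prob:
  assumes s: "inv T b 0 s" and T: "T = (k * (M + 1) + 1) * R"
  shows "halts_within d (T * (body_time n k + 2) + 1) (main_loop, s)"
    and "1 - (1 - \<delta> ^ (k * (M + 1) + 1)) ^ R \<le>
      measure_pmf.prob (run d (T * (body_time n k + 2) + 1) (main_loop, s))
        {cs. level T b M (k * (M + 1) + 1) (snd cs)}"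
proof -
  let ?N = "k * (M + 1) + 1"
  have guard: "bval d (NLess (NC 6) (NC 4)) s' \<longleftrightarrow> i < T" if "inv T b i s'" for i s'
    using that by (auto simp: inv_def core_def)
  have eq: "run d (T * (body_time n k + 2) + 1) (main_loop, s)
      = map_pmf (Pair Skip) (iter_pmf T kernel s)"
    unfolding main_loop_def kernel_def
    by (rule run_While_iter[where I = "inv T b", OF inv_step _ _ s]) (use guard in auto)
  then show "halts_within d (T * (body_time n k + 2) + 1) (main_loop, s)"
    by (auto simp: halts_within_def)
  let ?I = "{s. \<exists>i. inv T b i s}"
  have "1 - (1 - \<delta> ^ ?N) ^ R \<le> measure_pmf.prob (iter_pmf (?N * R) kernel s) {s. level T b M ?N s}"
  proof (rule iter_amplify[where I = ?I and G = "\<lambda>m. {s. level T b M m s}"])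
    show "set_pmf (kernel s) \<subseteq> ?I" if "s \<in> ?I" for s
      using that validD(2)[OF inv_step] by (fastforce simp: kernel_def)
    show "?I \<subseteq> {s. level T b M 0 s}"
      using pot_0 by (fastforce simp: inv_def level_def)
    show "\<delta> \<le> measure_pmf.prob (kernel s) {s. level T b M (Suc m) s}"
      if "s \<in> {s. level T b M m s}" "m < ?N" for s m
      unfolding prob_kernel using level_step that by simp
    \<comment> \<open>The top level exceeds the range of the potential, so good centers have been
      recorded there, and these are never lost.\<close>
    show "set_pmf (kernel s) \<subseteq> {s. level T b M ?N s}" if "s \<in> {s. level T b M ?N s}" for s
    proof -
      obtain i X Y \<beta> where "core T b i X Y \<beta> s" "admissible i X Y \<beta>" "0 < i \<and> \<beta> \<le> (1 + e) * V"
        using \<open>s \<in> {s. level T b M ?N s}\<close> unfolding level_def by auto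
      then show ?thesis using best_step by (fastforce simp: kernel_def)
    qed
    have "e / (64 * real k) \<le> 1" using e k by (simp add: field_simps)
    then show "\<delta> \<le> 1" using delta by linarith
    show "s \<in> ?I" using s by blast
  qed (use delta in auto)
  then show "1 - (1 - \<delta> ^ ?N) ^ R \<le>
      measure_pmf.prob (run d (T * (body_time n k + 2) + 1) (main_loop, s)) {cs. level T b M ?N (snd cs)}"
    unfolding eq T[symmetric] by (simp only: measure_map_pmf vimage_def mem_Collect_eq snd_conv)
qed

lemma main_prob:
  assumes s: "inv T b 0 s" and T: "T = (k * (M + 1) + 1) * R"
  shows "halts_within d (T * (body_time n k + 2) + k * 5 + 7) (Seq main_loop write_output, s)"
    and "1 - (1 - \<delta> ^ (k * (M + 1) + 1)) ^ R \<le>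
      measure_pmf.prob (run d (T * (body_time n k + 2) + k * 5 + 7) (Seq main_loop write_output, s))
        {cs. \<exists>Y. output_set (snd cs) = Y ` {..<k} \<and> (\<forall>j<k. Y j \<in> euclid d) \<and> W Y \<le> (1 + e) * V}"
proof -
  let ?N = "k * (M + 1) + 1"
  let ?t = "T * (body_time n k + 2) + 1"
  let ?good = "\<lambda>s. \<exists>Y. output_set s = Y ` {..<k} \<and> (\<forall>j<k. Y j \<in> euclid d) \<and> W Y \<le> (1 + e) * V"
  have loop: "valid d (inv T b 0) main_loop ?t (inv T b T)"
    unfolding main_loop_def
    by (rule valid_While[where I = "inv T b", OF inv_step]) (auto simp: inv_def core_def)
  have out: "valid d (inv T b T) write_output (k * 5 + 5) (\<lambda>_. True)"
  proof (rule validI)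
    fix s assume "inv T b T s"
    then obtain X Y \<beta> where "core T b T X Y \<beta> s" by (auto simp: inv_def)
    from validD(1)[OF write_output_valid this] show "halts_within d (k * 5 + 5) (write_output, s)" .
  qed simp
  have time: "Suc (?t + (k * 5 + 5)) = T * (body_time n k + 2) + k * 5 + 7" by simp
  from validD(1)[OF valid_Seq[OF out loop] s]
  show "halts_within d (T * (body_time n k + 2) + k * 5 + 7) (Seq main_loop write_output, s)"
    unfolding time .
  have final: "1 \<le> measure_pmf.prob (run d (k * 5 + 5) (write_output, s')) {cs. ?good (snd cs)}"
    if s': "level T b M ?N s'" for s'
  proof -
    obtain i X Y \<beta> where c: "core T b i X Y \<beta> s'" "admissible i X Y \<beta>" "0 < i" "\<beta> \<le> (1 + e) * V"
      using s' unfolding level_def by auto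
    have "valid d (core T b i X Y \<beta>) write_output (k * 5 + 5) ?good"
      by (rule valid_conseq[OF write_output_valid]) (use c in \<open>auto simp: admissible_def\<close>)
    from prob_valid[OF this c(1)] show ?thesis .
  qed
  have "(1 - (1 - \<delta> ^ ?N) ^ R) * 1 \<le> measure_pmf.prob
      (run d (Suc (?t + (k * 5 + 5))) (Seq main_loop write_output, s)) {cs. ?good (snd cs)}"
    by (rule prob_Seq[OF loop out s main_loop_prob(2)[OF s T]]) (use final in auto)
  then show "1 - (1 - \<delta> ^ ?N) ^ R \<le> measure_pmf.prob
      (run d (T * (body_time n k + 2) + k * 5 + 7) (Seq main_loop write_output, s)) {cs. ?good (snd cs)}"
    unfolding time by simp
qed

end

end

section \<open>Error probability and running time\<close>

text \<open>By \<open>1 - x \<le> exp (- x)\<close> and \<open>1 \<le> e * q\<close> the power is at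
  most \<open>exp (- 14 * q)\<close>. It has to be below \<open>e ^ 4 / 1024\<close>, and
  \<open>2 ^ 10 * q ^ 4\<close> is a product of 14 factors, each at most
  \<open>exp q\<close>.\<close>

lemma contraction_bound:
  fixes e :: real
  assumes e: "0 < e" "e < 1" and q: "1 / e \<le> real q"
  shows "(1 - e / 4) ^ (56 * (q * q)) * (16 / e)\<^sup>2 \<le> (e / 2)\<^sup>2"
proof -
  have "1 < 1 / e" using e by simp
  then have q1: "1 \<le> real q" using q by linarith
  have eq: "1 \<le> e * real q" using q e by (simp add: field_simps)
  have "(1 - e / 4) ^ (56 * (q * q)) \<le> exp (- e / 4) ^ (56 * (q * q))"
    using e exp_ge_add_one_self[of "- e / 4"] by (intro power_mono) auto
  also have "\<dots> = exp (real (56 * (q * q)) * (- e / 4))" by (simp only: exp_of_nat_mult)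
  also have "\<dots> \<le> exp (- 14 * real q)"
  proof -
    have "real q * 1 \<le> real q * (e * real q)" using eq by (intro mult_left_mono) auto
    then show ?thesis by (simp add: algebra_simps)
  qed
  finally have 1: "(1 - e / 4) ^ (56 * (q * q)) \<le> exp (- 14 * real q)" .
  have q_exp: "2 \<le> exp (real q)" "real q \<le> exp (real q)"
    using exp_ge_add_one_self[of "real q"] q1 by linarith+
  have "1024 * real q ^ 4 = 2 ^ 10 * real q ^ 4" by simp
  also have "\<dots> \<le> exp (real q) ^ 10 * exp (real q) ^ 4"
    using q_exp by (intro mult_mono power_mono) auto
  also have "\<dots> = exp (14 * real q)"
    by (simp add: exp_of_nat_mult[symmetric] exp_add[symmetric])
  finally have 2: "1024 * real q ^ 4 \<le> exp (14 * real q)" .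
  have "1 \<le> (e * real q) ^ 4" using eq by simp
  then have "1024 * 1 \<le> 1024 * (e ^ 4 * real q ^ 4)" by (intro mult_left_mono) (auto simp: power_mult_distrib)
  also have "\<dots> = e ^ 4 * (1024 * real q ^ 4)" by simp
  also have "\<dots> \<le> e ^ 4 * exp (14 * real q)" using 2 by (intro mult_left_mono) auto
  finally have "exp (- 14 * real q) \<le> e ^ 4 / 1024"
    by (simp add: exp_minus field_simps)
  then have "(1 - e / 4) ^ (56 * (q * q)) * (16 / e)\<^sup>2 \<le> e ^ 4 / 1024 * (16 / e)\<^sup>2"
    using 1 by (intro mult_right_mono) auto
  also have "\<dots> = (e / 2)\<^sup>2" using e by (simp add: field_simps power2_eq_square eval_nat_numeral)
  finally show ?thesis .
qed

text \<open>With \<open>Z = D ^ N\<close>, the failure probability is at most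
  \<open>exp (- 1 / Z)\<close> to the power \<open>Z * a * n\<close>, that is
  \<open>exp (- a * n)\<close>; then \<open>n + 1 \<le> exp n\<close>.\<close>

lemma amplification_bound:
  fixes D N n a :: nat
  assumes "1 \<le> D"
  shows "1 - 1 / (real n + 1) ^ a \<le> 1 - (1 - (1 / real D) ^ N) ^ (D ^ N * (a * n))"
proof -
  define Z where "Z = real (D ^ N)"
  have Z: "1 \<le> Z" unfolding Z_def using one_le_power[OF assms, of N] by linarith
  have "(1 - 1 / Z) ^ (D ^ N * (a * n)) \<le> exp (- 1 / Z) ^ (D ^ N * (a * n))"
    using Z exp_ge_add_one_self[of "- 1 / Z"] by (intro power_mono) auto
  also have "\<dots> = exp (real (D ^ N * (a * n)) * (- 1 / Z))" by (simp only: exp_of_nat_mult)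
  also have "real (D ^ N * (a * n)) * (- 1 / Z) = - real (a * n)"
    using assms by (simp add: Z_def)
  also have "exp (- real (a * n)) = 1 / exp (real n) ^ a"
    by (simp add: exp_minus exp_of_nat_mult field_simps)
  also have "\<dots> \<le> 1 / (real n + 1) ^ a"
    using exp_ge_add_one_self[of "real n", unfolded add.commute[of 1]]
    by (intro divide_left_mono power_mono mult_pos_pos) auto
  finally show ?thesis by (simp add: Z_def power_one_over)
qed

section \<open>Running time\<close>

definition total_time :: "nat \<Rightarrow> nat \<Rightarrow> nat \<Rightarrow> nat \<Rightarrow> nat" where
  "total_time a n k q = (let N = k * (56 * (q * q) + 1) + 1; T = N * ((64 * (k * q)) ^ N * (a * n)) in
     q * 3 + N * 8 + T * 3 + 96 * (n * q) + 22 + (T * (body_time n k + 2) + k * 5 + 7))"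

text \<open>There are at most \<open>D * D * Z * n * a\<close> rounds by
  \<open>N \<le> D * D\<close>, each of at most \<open>2 * D * n\<close> steps, so the main loop
  accounts for \<open>2 * (a * y)\<close>; all other summands are bounded by multiples of
  \<open>y\<close> as well.\<close>

lemma total_time_le:
  assumes "1 \<le> n" "1 \<le> k" "1 \<le> q"
  defines "D \<equiv> 64 * (k * q)" and "N \<equiv> k * (56 * (q * q) + 1) + 1"
  shows "total_time a n k q \<le> (5 * a + 52) * (D ^ (N + 3) * (n * n))"
proof -
  define Z where "Z = D ^ N"
  define y where "y = D ^ (N + 3) * (n * n)"
  have y: "y = D * D * D * Z * n * n" by (simp add: y_def Z_def power_add eval_nat_numeral)
  have "1 \<le> k * q" using assms by (simp add: Suc_leI)
  then have D1: "1 \<le> D" by (simp add: D_def)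
  then have Z1: "1 \<le> Z" by (simp add: Z_def)
  have N: "N \<le> D * D"
  proof -
    have "1 \<le> k * (q * q)" "k * 1 \<le> k * (q * q)" using assms by (auto simp: Suc_leI)
    moreover have "N = 56 * (k * (q * q)) + k + 1" by (simp add: N_def algebra_simps)
    ultimately have "N \<le> 58 * (k * (q * q))" by linarith
    also have "\<dots> \<le> 4096 * ((k * k) * (q * q))"
    proof -
      have "1 * (k * (q * q)) \<le> k * (k * (q * q))" using assms by (intro mult_right_mono) auto
      then show ?thesis by simp
    qed
    finally show ?thesis by (simp add: D_def algebra_simps)
  qed
  have q: "q \<le> D" and k: "5 * k \<le> D" using assms by (auto simp: D_def)
  have nk: "body_time n k + 2 \<le> 2 * D * n"
  proof -
    have "n \<le> n * k" "k \<le> n * k" "1 \<le> n * k" using assms by (auto simp: Suc_leI)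
    moreover have "body_time n k + 2 = 6 * (n * k) + 27 * n + 5 * k + 33" by (simp add: algebra_simps)
    ultimately have "body_time n k + 2 \<le> 71 * (n * k)" by linarith
    also have "\<dots> \<le> 128 * (n * k) * q" using assms by simp
    finally show ?thesis by (simp add: D_def algebra_simps)
  qed
  have T: "N * (Z * (a * n)) \<le> D * D * Z * n * a"
  proof -
    have "N * (Z * (a * n)) \<le> D * D * (Z * (a * n))" using N by (rule mult_right_mono) simp
    then show ?thesis by (simp add: algebra_simps)
  qed
  have Dy: "D * D \<le> y" "n * D \<le> y" "D \<le> y" "1 \<le> y"
  proof -
    have *: "1 \<le> D * Z * n * n" "1 \<le> D * D * Z * n" "1 \<le> D * D * Z * n * n" using assms D1 Z1 by (auto simp: Suc_leI)
    show "D * D \<le> y" using mult_le_mono2[OF *(1), of "D * D"] by (simp add: y algebra_simps)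
    show "n * D \<le> y" using mult_le_mono2[OF *(2), of "n * D"] by (simp add: y algebra_simps)
    show "D \<le> y" using mult_le_mono2[OF *(3), of "D"] by (simp add: y algebra_simps)
    then show "1 \<le> y" using D1 by linarith
  qed
  have T1: "N * (Z * (a * n)) \<le> a * y"
  proof -
    have "D * D * Z * n * a * 1 \<le> D * D * Z * n * a * (D * n)"
      using assms D1 by (intro mult_le_mono2) (simp add: Suc_leI)
    moreover have "D * D * Z * n * a * (D * n) = a * y" by (simp add: y algebra_simps)
    ultimately show ?thesis using T by linarith
  qed
  have T2: "N * (Z * (a * n)) * (body_time n k + 2) \<le> 2 * (a * y)"
  proof -
    have "D * D * Z * n * a * (2 * D * n) = 2 * (a * y)" by (simp add: y algebra_simps)
    then show ?thesis using mult_le_mono[OF T nk] by (simp only:)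
  qed
  have nq: "96 * (n * q) \<le> 2 * y"
  proof -
    have "96 * (n * q) \<le> 128 * (n * q) * k" using assms by simp
    also have "\<dots> = 2 * (n * D)" by (simp add: D_def algebra_simps)
    finally show ?thesis using Dy(2) by linarith
  qed
  have "total_time a n k q = q * 3 + N * 8 + N * (Z * (a * n)) * 3 + 96 * (n * q) + 22 +
      (N * (Z * (a * n)) * (body_time n k + 2) + k * 5 + 7)"
    by (simp only: total_time_def Let_def D_def N_def Z_def)
  also have "\<dots> \<le> 3 * y + 8 * y + 3 * (a * y) + 2 * y + 22 * y + (2 * (a * y) + y + 7 * y)"
    using q k N T1 T2 nq Dy by linarith
  also have "\<dots> \<le> (5 * a + 52) * y" by (simp add: algebra_simps)
  finally show ?thesis by (simp only: y_def)
qed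

text \<open>The exponent is of order \<open>N * log D\<close> with \<open>N = O(k / e ^ 2)\<close>
  and \<open>log D = O(log k + log (1 / e))\<close>, which leaves room in the powers of
  \<open>1 / e\<close> and of its logarithm. The constant 8352 is
  \<open>4 * 232 * 9\<close>.\<close>

lemma total_time_bound:
  assumes n: "1 \<le> n" and k: "1 \<le> k" and e: "0 < e" "e < 1" and q: "1 \<le> q" "real q \<le> 2 / e"
  shows "real (total_time a n k q) \<le> time_bound (8352 + 5 * real a + 52) 2 n k e"
proof -
  define D where "D = 64 * (k * q)"
  define N where "N = k * (56 * (q * q) + 1) + 1"
  define L where "L = lg (real k)"
  define l where "l = lg (1 / e)"
  define E where "E = real k * L * (1 / e) ^ 5 * l\<^sup>2"
  have L: "1 \<le> L" "log 2 (real k) \<le> L" and l: "1 \<le> l" "log 2 (1 / e) \<le> l"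
    by (auto simp: L_def l_def lg_def)
  have e1: "1 \<le> 1 / e" using e by simp
  have D1: "1 \<le> D" using k q by (simp add: D_def Suc_leI)
  have N1: "1 \<le> N" by (simp add: N_def)
  have "log 2 (real D) = log 2 (64 * (real k * real q))" by (simp add: D_def)
  also have "\<dots> = 6 + log 2 (real k) + log 2 (real q)"
    using k q log_pow_cancel[of 2 6] by (simp add: log_mult)
  also have "log 2 (real q) \<le> log 2 (2 * (1 / e))" using q e by (subst log_le_cancel_iff) auto
  also have "log 2 (2 * (1 / e)) = 1 + log 2 (1 / e)" using e by (subst log_mult) auto
  finally have "log 2 (real D) \<le> 7 + L + l" using L l by linarith
  also have "\<dots> \<le> 9 * (L * l)"
  proof -
    have "1 * 1 \<le> L * l" "L * 1 \<le> L * l" "1 * l \<le> L * l" using L l by (intro mult_mono; simp)+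
    then show ?thesis by linarith
  qed
  finally have logD: "log 2 (real D) \<le> 9 * (L * l)" .
  have "real N \<le> 58 * (real k * (real q * real q))"
  proof -
    have "1 \<le> k * (q * q)" "k * 1 \<le> k * (q * q)" using k q by (auto simp: Suc_leI)
    moreover have "N = 56 * (k * (q * q)) + k + 1" by (simp add: N_def algebra_simps)
    ultimately have "N \<le> 58 * (k * (q * q))" by linarith
    then have "real N \<le> real (58 * (k * (q * q)))" by (rule of_nat_mono)
    then show ?thesis by simp
  qed
  also have "\<dots> \<le> 58 * (real k * ((2 / e) * (2 / e)))"
    using q e by (intro mult_left_mono mult_mono) auto
  finally have N: "real N \<le> 232 * (real k * (1 / e)\<^sup>2)" by (simp add: power2_eq_square)
  have "0 \<le> log 2 (real D)" using D1 by simp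
  then have "4 * real N * log 2 (real D) \<le> 4 * (232 * (real k * (1 / e)\<^sup>2)) * (9 * (L * l))"
    using N logD by (intro mult_mono) auto
  also have "\<dots> = 8352 * (real k * L * ((1 / e)\<^sup>2 * l))" by simp
  also have "\<dots> \<le> 8352 * (real k * L * ((1 / e) ^ 5 * l\<^sup>2))"
    using e e1 l L power_increasing[of 2 5 "1 / e"] power_increasing[of 1 2 l]
    by (intro mult_left_mono mult_mono) auto
  finally have exponent: "4 * real N * log 2 (real D) \<le> 8352 * E" by (simp add: E_def mult.assoc)
  have one_le_mult: "1 \<le> x * y" if "1 \<le> x" "1 \<le> y" for x y :: real
    using mult_mono[OF that] that by simp
  have "1 \<le> E"
    unfolding E_def by (intro one_le_mult one_le_power) (use k L l e1 in auto)
  \<comment> \<open>The constant factor is bounded by a power of 2 and moved into the exponent,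
    where \<open>1 \<le> E\<close> absorbs it.\<close>
  then have E: "(5 * real a + 52) * 1 \<le> (5 * real a + 52) * E" by (intro mult_left_mono) auto
  have "real (total_time a n k q) \<le> real ((5 * a + 52) * (D ^ (N + 3) * (n * n)))"
    unfolding D_def N_def using total_time_le[OF n k q(1)] by (rule of_nat_mono)
  also have "\<dots> = real (5 * a + 52) * (real D ^ (N + 3) * real n ^ 2)" by (simp add: power2_eq_square)
  also have "\<dots> \<le> 2 ^ (5 * a + 52) * (real D ^ (4 * N) * real n ^ 2)"
  proof (intro mult_mono)
    show "real (5 * a + 52) \<le> 2 ^ (5 * a + 52)" using of_nat_less_two_power[of "5 * a + 52"] by (simp add: less_imp_le del: of_nat_add)
    show "real D ^ (N + 3) \<le> real D ^ (4 * N)" using D1 N1 by (intro power_increasing) auto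
  qed auto
  also have "real D ^ (4 * N) = (2 powr log 2 (real D)) powr real (4 * N)"
    using D1 powr_realpow[of "real D" "4 * N"] by simp
  also have "\<dots> = 2 powr (4 * real N * log 2 (real D))" by (simp add: powr_powr mult.commute)
  also have "(2::real) ^ (5 * a + 52) = 2 powr (5 * real a + 52)"
    using powr_realpow[of 2 "5 * a + 52"] by simp
  also have "2 powr (5 * real a + 52) * (2 powr (4 * real N * log 2 (real D)) * real n ^ 2)
      = 2 powr (5 * real a + 52 + 4 * real N * log 2 (real D)) * real n ^ 2"
    by (simp add: powr_add)
  also have "\<dots> \<le> 2 powr ((8352 + 5 * real a + 52) * E) * real n ^ 2"
    using exponent E by (intro mult_right_mono powr_mono) (auto simp: algebra_simps)
  finally show ?thesis by (simp add: time_bound_def E_def L_def l_def)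
qed

context hybrid
begin

section \<open>Verification of the prelude and of the whole program\<close>

definition initial :: "state \<Rightarrow> bool" where
  "initial s \<longleftrightarrow> nmem s 0 = n \<and> nmem s 1 = k \<and> nmem s 6 = 0 \<and>
     rmem s 0 = r \<and> rmem s 1 = e \<and> rmem s 2 = 0 \<and>
     (\<forall>p<n. pmem s p = pt p) \<and> (\<forall>p\<ge>n. pmem s p = (\<lambda>_. 0))"

lemma prelude_valid:
  assumes q: "\<And>i. real i < 1 / e \<longleftrightarrow> i < q"
    and N: "N = k * (56 * (q * q) + 1) + 1"
    and T: "T = N * ((64 * (k * q)) ^ N * (a * n))" and b: "b = 32 * (n * q)"
  shows "valid d initial (prelude a) (q * 3 + N * 8 + T * 3 + 96 * (n * q) + 21) (inv T b 0)"
proof -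
  let ?P2 = "\<lambda>s. initial s \<and> nmem s 2 = q"
  let ?P3 = "\<lambda>s. ?P2 s \<and> nmem s 3 = N"
  let ?P = "\<lambda>i s. ?P3 s \<and> rmem s 7 = real ((64 * (k * q)) ^ i)"
  let ?P4 = "\<lambda>s. ?P N s \<and> nmem s 4 = T"
  have 1: "valid d initial (ceil_loop 2 (RDiv (RN 1) (RC 1))) (q * 3 + 3) ?P2"
    by (rule valid_ceil_loop[where y = "1 / e"]) (auto simp: initial_def q)
  have 2: "valid d ?P2 (ceil_loop 3 (RAdd (RMul (RNat (NC 1))
      (RAdd (RMul (RN 56) (RMul (RNat (NC 2)) (RNat (NC 2)))) (RN 1))) (RN 1))) (N * 3 + 3) ?P3"
  proof (rule valid_ceil_loop[where y = "real N"])
    show "rval d (RAdd (RMul (RNat (NC 1))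
      (RAdd (RMul (RN 56) (RMul (RNat (NC 2)) (RNat (NC 2)))) (RN 1))) (RN 1)) s = real N" if "?P2 s" for s
      using that by (simp add: initial_def N algebra_simps)
  qed (auto simp: initial_def)
  have 3: "valid d ?P3 (rset 7 (RN 1)) 1 (?P 0)"
    by (rule valid_pre[OF valid_RAssign]) (auto simp: initial_def)
  have 4: "valid d (?P 0) (For 12 (NC 3)
      (rset 7 (RMul (RMul (RN 64) (RMul (RNat (NC 1)) (RNat (NC 2)))) (RC 7)))) (N * (1 + 4) + 3) (?P N)"
  proof (rule valid_For)
    show "valid d (\<lambda>s. ?P i s \<and> nmem s 12 = i)
        (rset 7 (RMul (RMul (RN 64) (RMul (RNat (NC 1)) (RNat (NC 2)))) (RC 7))) 1
        (\<lambda>s. ?P (Suc i) s \<and> nmem s 12 = i)" for i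
      by (rule valid_pre[OF valid_RAssign]) (simp_all add: initial_def)
  qed (auto simp: initial_def)
  have 5: "valid d (?P N) (ceil_loop 4 (RMul (RNat (NC 3)) (RMul (RC 7) (RMul (RN a) (RNat (NC 0))))))
      (T * 3 + 3) ?P4"
  proof (rule valid_ceil_loop[where y = "real T"])
    show "rval d (RMul (RNat (NC 3)) (RMul (RC 7) (RMul (RN a) (RNat (NC 0))))) s = real T"
      if "?P N s" for s
      using that by (simp add: initial_def T)
  qed (auto simp: initial_def)
  have 6: "valid d ?P4 (ceil_loop 5 (RMul (RN 32) (RMul (RNat (NC 0)) (RNat (NC 2))))) (b * 3 + 3)
      (\<lambda>s. ?P4 s \<and> nmem s 5 = b)"
  proof (rule valid_ceil_loop[where y = "real b"])
    show "rval d (RMul (RN 32) (RMul (RNat (NC 0)) (RNat (NC 2)))) s = real b" if "?P4 s" for s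
      using that by (simp add: initial_def b)
  qed (auto simp: initial_def)
  have final: "inv T b 0 s" if "?P4 s \<and> nmem s 5 = b" for s
  proof -
    \<comment> \<open>The point cells beyond the clients are 0: the search starts with all centers
      at the origin, and the recorded centers are placeholders.\<close>
    have "core T b 0 (\<lambda>_ _. 0) (\<lambda>_ _. 0) 0 s" using that by (auto simp: core_def initial_def)
    moreover have "admissible 0 (\<lambda>_ _. 0) (\<lambda>_ _. 0) 0" by (simp add: admissible_def euclid_eq)
    ultimately show ?thesis unfolding inv_def by blast
  qed
  show ?thesis unfolding prelude_def
    by (rule valid_conseq[OF valid_Seq[OF valid_Seq[OF valid_Seq[OF valid_Seq[OF valid_Seq[OF 6 5] 4] 3] 2] 1]
          _ final]) (auto simp: b)
qed

lemma program_correct: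
  assumes n: "1 \<le> n" and pt: "\<And>p. p < n \<Longrightarrow> pt p \<in> euclid d"
    and q: "\<And>i. real i < 1 / e \<longleftrightarrow> i < q" and s: "initial s"
  shows "halts_within d (total_time a n k q) (program a, s)"
    and "1 - 1 / (real n + 1) ^ a \<le> measure_pmf.prob (run d (total_time a n k q) (program a, s))
      {cs. \<exists>Y. output_set (snd cs) = Y ` {..<k} \<and> (\<forall>j<k. Y j \<in> euclid d) \<and> W Y \<le> (1 + e) * V}"
proof -
  let ?good = "\<lambda>s. \<exists>Y. output_set s = Y ` {..<k} \<and> (\<forall>j<k. Y j \<in> euclid d) \<and> W Y \<le> (1 + e) * V"
  define M where "M = 56 * (q * q)"
  define N where "N = k * (M + 1) + 1"
  define D where "D = 64 * (k * q)"
  define R where "R = D ^ N * (a * n)"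
  define T where "T = N * R"
  define b where "b = 32 * (n * q)"
  define t1 where "t1 = q * 3 + N * 8 + T * 3 + 96 * (n * q) + 21"
  define t2 where "t2 = T * (body_time n k + 2) + k * 5 + 7"
  have qe: "1 / e \<le> real q" using q[of q] by linarith
  then have q1: "1 \<le> q" using e by (cases q) auto
  have D1: "1 \<le> D" using k q1 by (simp add: D_def Suc_leI)
  have Mb: "(1 - e / 4) ^ M * (16 / e)\<^sup>2 \<le> (e / 2)\<^sup>2"
    unfolding M_def using e qe by (rule contraction_bound)
  have "32 * real n * (1 / e) \<le> 32 * real n * real q" using qe by (intro mult_left_mono) auto
  then have bb: "32 * real n / e \<le> real (b + 1)" by (simp add: b_def)
  have "1 / real q \<le> e" using qe e q1 by (simp add: field_simps)
  \<comment> \<open>\<open>1 / D\<close> underestimates the lucky probability with \<open>q\<close>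
    in place of \<open>1 / e\<close>, so that the number of iterations is a natural number the
    program can compute.\<close>
  then have "1 / real D \<le> e / (64 * real k)"
    using k q1 by (simp add: D_def field_simps)
  note main = main_prob[OF n pt Mb bb _ this _ T_def[unfolded N_def], folded N_def]
  have pre: "valid d initial (prelude a) t1 (inv T b 0)"
    unfolding t1_def by (rule prelude_valid[OF q]) (simp_all add: N_def M_def T_def R_def D_def b_def)
  have rest: "valid d (inv T b 0) (Seq main_loop write_output) t2 (\<lambda>_. True)"
    unfolding t2_def by (rule validI) (use main(1) in auto)
  have time: "total_time a n k q = Suc (t1 + t2)"
    by (simp add: total_time_def Let_def t1_def t2_def T_def R_def N_def M_def D_def)
  show "halts_within d (total_time a n k q) (program a, s)"
    unfolding time program_def using validD(1)[OF valid_Seq[OF rest pre] s] .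
  have "1 * (1 - 1 / (real n + 1) ^ a) \<le> measure_pmf.prob (run d (Suc (t1 + t2)) (program a, s)) {cs. ?good (snd cs)}"
    unfolding program_def
  proof (rule prob_Seq[OF pre rest s prob_valid[OF pre s]])
    fix s' assume "inv T b 0 s'"
    have "1 - 1 / (real n + 1) ^ a \<le> 1 - (1 - (1 / real D) ^ N) ^ R"
      unfolding R_def by (rule amplification_bound[OF D1])
    also have "\<dots> \<le> measure_pmf.prob (run d t2 (Seq main_loop write_output, s')) {cs. ?good (snd cs)}"
      unfolding t2_def by (rule main(2)) (use \<open>inv T b 0 s'\<close> in auto)
    finally show "1 - 1 / (real n + 1) ^ a \<le> \<dots>" .
  qed (simp add: field_simps)
  then show "1 - 1 / (real n + 1) ^ a \<le> measure_pmf.prob (run d (total_time a n k q) (program a, s)) {cs. ?good (snd cs)}"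
    unfolding time by simp
qed

end

theorem theorem1:
  fixes a :: nat
  shows "\<exists>prog :: com. \<exists>C :: real. \<exists>c :: nat.
    \<forall>(d :: nat) (P :: point set) (ps :: point list) (k :: nat) (r :: real) (\<epsilon> :: real).
      finite P \<and> P \<noteq> {} \<and> P \<subseteq> euclid d \<and> set ps = P \<and> distinct ps \<and>
      k \<ge> 1 \<and> r \<ge> 0 \<and> 0 < \<epsilon> \<and> \<epsilon> < 1 \<longrightarrow>
      (\<exists>t :: nat.
        real t \<le> time_bound C c (card P) k \<epsilon> \<and>
        halts_within d t (prog, input_state ps k r \<epsilon>) \<and>
        measure_pmf.prob (run d t (prog, input_state ps k r \<epsilon>))
          {cs. bicriteria_approx (euclid_dist d) (euclid d) P k r (1 + \<epsilon>) (1 + \<epsilon>) (output_set (snd cs))}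
        \<ge> 1 - 1 / (real (card P) + 1) ^ a)"
\<comment> \<open>The exponent \<open>a\<close> of the error bound affects the program and the
  constant \<open>C\<close>, but not the degree 2 in \<open>n\<close>.\<close>
proof (rule exI[of _ "program a"], rule exI[of _ "8352 + 5 * real a + 52"], rule exI[of _ 2],
    intro allI impI, elim conjE)
  fix d :: nat and P :: "point set" and ps :: "point list" and k :: nat and r \<epsilon> :: real
  assume P: "finite P" "P \<noteq> {}" "P \<subseteq> euclid d" "set ps = P" "distinct ps"
    and k: "k \<ge> 1" and r: "r \<ge> 0" and eps: "0 < \<epsilon>" "\<epsilon> < 1"
  define n where "n = length ps"
  have card: "card P = n" using P(4,5) distinct_card by (auto simp: n_def)
  have n: "1 \<le> n" using P(2,4) by (cases ps) (auto simp: n_def)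
  obtain opt where opt: "\<And>j. opt j \<in> euclid d"
    "cost (euclid_dist d) r P (opt ` {..<k}) \<le> OPT (euclid_dist d) (euclid d) P k r"
    using OPT_attained[OF P(1) k] by metis
  \<comment> \<open>With an optimal family for \<open>opt\<close>, \<open>V\<close> is at most the
    optimum, so a guarantee relative to \<open>V\<close> is one relative to
    \<open>OPT\<close>.\<close>
  interpret hybrid d n k "(!) ps" r \<epsilon> opt
    using k r eps by unfold_locales
  have sum_P: "(\<Sum>p\<in>P. f p) = (\<Sum>i<n. f (ps ! i))" for f :: "point \<Rightarrow> real"
    using sum.reindex_bij_betw[OF bij_betw_nth[OF P(5) refl refl], of f] P(4) by (simp add: n_def)
  define q where "q = nat \<lceil>1 / \<epsilon>\<rceil>"
  have q: "real i < 1 / \<epsilon> \<longleftrightarrow> i < q" for i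
    unfolding q_def using eps by (simp add: less_ceiling_iff zless_nat_eq_int_zless)
  have q1: "1 \<le> q" using q[of 0] eps by simp
  have "1 \<le> 1 / \<epsilon>" using eps by simp
  then have q2: "real q \<le> 2 / \<epsilon>" using q[of "q - 1"] q1 by simp
  have init: "initial (input_state ps k r \<epsilon>)"
    unfolding initial_def input_state_def by (simp add: n_def)
  have pt: "ps ! p \<in> euclid d" if "p < n" for p using that P by (auto simp: n_def)
  note correct = program_correct[OF n pt q init, of a]
  have approx: "bicriteria_approx (euclid_dist d) (euclid d) P k r (1 + \<epsilon>) (1 + \<epsilon>) X"
    if Y: "X = Y ` {..<k}" "\<forall>j<k. Y j \<in> euclid d" "W Y \<le> (1 + \<epsilon>) * V" for X Y
  proof -
    have "cost (euclid_dist d) ((1 + \<epsilon>) * r) P X = W Y"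
      unfolding Y(1) cost_image sum_P w_def ..
    also have "\<dots> \<le> (1 + \<epsilon>) * cost (euclid_dist d) r P (opt ` {..<k})"
      using Y(3) unfolding cost_image sum_P v_def .
    also have "\<dots> \<le> (1 + \<epsilon>) * OPT (euclid_dist d) (euclid d) P k r"
      using opt(2) eps by (intro mult_left_mono) auto
    finally have "cost (euclid_dist d) ((1 + \<epsilon>) * r) P X \<le> (1 + \<epsilon>) * OPT (euclid_dist d) (euclid d) P k r" .
    moreover have "card X \<le> k" unfolding Y(1) using card_image_le[of "{..<k}" Y] by simp
    ultimately show ?thesis
      using Y k by (auto simp: bicriteria_approx_def solutions_def lessThan_empty_iff)
  qed
  show "\<exists>t. real t \<le> time_bound (8352 + 5 * real a + 52) 2 (card P) k \<epsilon> \<and>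
      halts_within d t (program a, input_state ps k r \<epsilon>) \<and>
      1 - 1 / (real (card P) + 1) ^ a \<le> measure_pmf.prob (run d t (program a, input_state ps k r \<epsilon>))
        {cs. bicriteria_approx (euclid_dist d) (euclid d) P k r (1 + \<epsilon>) (1 + \<epsilon>) (output_set (snd cs))}"
  proof (intro exI conjI)
    show "real (total_time a n k q) \<le> time_bound (8352 + 5 * real a + 52) 2 (card P) k \<epsilon>"
      unfolding card by (rule total_time_bound[OF n k eps q1 q2])
    show "halts_within d (total_time a n k q) (program a, input_state ps k r \<epsilon>)"
      by (rule correct(1))
    show "1 - 1 / (real (card P) + 1) ^ a
        \<le> measure_pmf.prob (run d (total_time a n k q) (program a, input_state ps k r \<epsilon>))
          {cs. bicriteria_approx (euclid_dist d) (euclid d) P k r (1 + \<epsilon>) (1 + \<epsilon>) (output_set (snd cs))}"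
      unfolding card
    proof (rule order_trans)
      show "1 - 1 / (real n + 1) ^ a \<le> measure_pmf.prob
          (run d (total_time a n k q) (program a, input_state ps k r \<epsilon>))
          {cs. \<exists>Y. output_set (snd cs) = Y ` {..<k} \<and> (\<forall>j<k. Y j \<in> euclid d) \<and> W Y \<le> (1 + \<epsilon>) * V}"
        by (rule correct(2))
    qed (use approx in \<open>auto intro!: measure_pmf.finite_measure_mono\<close>)
  qed
qed

end
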